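(* Let $c_0=1$, let $c_1,\ldots,c_d$ be multiplicatively independent non-zero integers, let $\Gamma$ be a star-extremal graph on the vertex set $\{0,1,\ldots,d\}$, and let $\mathcal{F}$ be the family of 2-variable equations $\{c_ix_1=c_jx_2:\ ij \text{ an edge of }\Gamma\}$. Then for every non-trivial Polish divisible compact abelian group $G$ we have $d_{\mathcal{F}}(G)=1/\chi_c(\Gamma)=1/\chi_f(\Gamma)$.
   Context: Non-zero integers $c_1,\dots,c_d$ are multiplicatively independent if whenever $c_1^{k_1}\cdots c_d^{k_d}=1$ with $k_i\in\mathbb{Z}$, we have $k_i=0$ for every $i$. For a finite graph $\Gamma$, the circular chromatic number $\chi_c(\Gamma)$ is the infimum over all real numbers $q$ such that for each vertex $v$ of $\Gamma$ there exists an open interval $A_v\subseteq\mathbb{T}=\mathbb{R}/\mathbb{Z}$ with $\mu(A_v)=1/q$ ($\mu$ the Haar probability measure), such that $A_u\cap A_v=\emptyset$ for every edge $uv$ in $\Gamma$. The fractional chromatic number $\chi_f(\Gamma)$ is the infimum over all real numbers $q$ such that for each vertex $v$ there exists a measurable set $A_v\subseteq[0,1)$ with Lebesgue measure $1/q$ such that $A_u\cap A_v=\emptyset$ for every edge $uv$ in $\Gamma$. The graph $\Gamma$ is star-extremal if $\chi_f(\Gamma)=\chi_c(\Gamma)$. For a compact abelian group $G$ with Haar probability measure $\mu$ on its Borel $\sigma$-algebra $\mathcal{B}_G$, and a finite family $\mathcal{F}$ of equations in two variables $x_1,x_2$, a set $A\subseteq G$ is $\mathcal{F}$-free if there are no solutions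 $(x_1,x_2)\in A^2$ to any of the equations in $\mathcal{F}$, and $d_{\mathcal{F}}(G)=\sup\{\mu(A):A\in\mathcal{B}_G \text{ is } \mathcal{F}\text{-free}\}$. *)

theory Defs
  imports
    "HOL-Probability.Probability_Measure"
    "Graph_Theory.Pair_Digraph"
begin

definition multiplicatively_independent :: "'i set \<Rightarrow> ('i \<Rightarrow> int) \<Rightarrow> bool" where
  "multiplicatively_independent I c \<longleftrightarrow>
     (\<forall>k :: 'i \<Rightarrow> int. (\<Prod>i\<in>I. (of_int (c i) :: rat) powi k i) = 1 \<longrightarrow> (\<forall>i\<in>I. k i = 0))"

text \<open>
  A finite simple graph is a \<^locale>\<open>pair_graph\<close>: every edge \<open>uv\<close> is recorded as the two arcs
  \<open>(u, v)\<close> and \<open>(v, u)\<close>.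

  The circle \<open>\<real>/\<int>\<close> is represented by its fundamental domain \<open>[0,1)\<close>: the quotient map is
  \<^const>\<open>frac\<close> and the Haar probability measure is Lebesgue measure on \<open>[0,1)\<close>. An open
  interval of the circle is the image of an open interval of the line.
\<close>

definition circle_open_interval :: "real set \<Rightarrow> bool" where
  "circle_open_interval A \<longleftrightarrow> (\<exists>a b. a < b \<and> A = frac ` {a<..<b})"

text \<open>
  In both chromatic numbers \<open>q > 0\<close> is required explicitly because \<open>1 / 0 = 0\<close>, so that \<open>q = 0\<close>
  would otherwise admit null sets. Since \<^const>\<open>Inf\<close> is taken over the reals, the definitions are
  meaningful only for loopless graphs, where some \<open>q\<close> is admissible.
\<close>

definition circular_chromatic_number :: "'v pair_pre_digraph \<Rightarrow> real" where
  "circular_chromatic_number \<Gamma> =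
     Inf {q. q > 0 \<and>
       (\<exists>A :: 'v \<Rightarrow> real set.
          (\<forall>v\<in>pverts \<Gamma>. circle_open_interval (A v) \<and> measure lebesgue (A v) = 1 / q) \<and>
          (\<forall>(u, v)\<in>parcs \<Gamma>. A u \<inter> A v = {}))}"

definition fractional_chromatic_number :: "'v pair_pre_digraph \<Rightarrow> real" where
  "fractional_chromatic_number \<Gamma> =
     Inf {q. q > 0 \<and>
       (\<exists>A :: 'v \<Rightarrow> real set.
          (\<forall>v\<in>pverts \<Gamma>. A v \<subseteq> {0..<1} \<and> A v \<in> sets lebesgue \<and> measure lebesgue (A v) = 1 / q) \<and>
          (\<forall>(u, v)\<in>parcs \<Gamma>. A u \<inter> A v = {}))}"

definition star_extremal :: "'v pair_pre_digraph \<Rightarrow> bool" where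
  "star_extremal \<Gamma> \<longleftrightarrow> fractional_chromatic_number \<Gamma> = circular_chromatic_number \<Gamma>"

definition int_multiple :: "int \<Rightarrow> 'a::ab_group_add \<Rightarrow> 'a" where
  "int_multiple k x =
     (if k \<ge> 0 then ((+) x ^^ nat k) 0 else - (((+) x ^^ nat (- k)) 0))"

definition divisible_group :: "'a::ab_group_add itself \<Rightarrow> bool" where
  "divisible_group _ \<longleftrightarrow> (\<forall>n::int. n > 0 \<longrightarrow> (\<forall>x::'a. \<exists>y. int_multiple n y = x))"

definition haar_probability :: "'a::topological_ab_group_add measure \<Rightarrow> bool" where
  "haar_probability M \<longleftrightarrow>
     sets M = sets borel \<and> prob_space M \<and>
     (\<forall>g. \<forall>A\<in>sets borel. emeasure M ((\<lambda>x. g + x) ` A) = emeasure M A)"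

text \<open>A pair \<open>(a, b)\<close> of integers encodes the equation \<open>a x\<^sub>1 = b x\<^sub>2\<close>.\<close>

definition equation_free :: "(int \<times> int) set \<Rightarrow> 'a::ab_group_add set \<Rightarrow> bool" where
  "equation_free F A \<longleftrightarrow>
     (\<forall>(a, b)\<in>F. \<not> (\<exists>x1\<in>A. \<exists>x2\<in>A. int_multiple a x1 = int_multiple b x2))"

text \<open>The measure \<open>M\<close> is meant to be the Haar probability measure of the group.\<close>

definition free_density :: "(int \<times> int) set \<Rightarrow> 'a::topological_ab_group_add measure \<Rightarrow> real" where
  "free_density F M = Sup {measure M A | A. A \<in> sets borel \<and> equation_free F A}"

end

theory Submission
  imports Defs
begin

text \<open>
  Upper bound: multiplication by a nonzero integer preserves the Haar measure of a divisible group,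
  so the preimages of a free set under multiplication by \<open>\<Prod>u\<noteq>v. c u\<close> form a fractional colouring,
  which only depends on the joint distribution of these finitely many events and can therefore be
  transported to \<open>[0,1)\<close>.

  Lower bound: round a circular colouring to arcs \<open>{a v, \<dots>, a v + r - 1}\<close> of \<open>\<int>/N\<close>. It suffices to find
  a measurable \<open>g\<close> with \<open>g (c i x) = g x + a i - a 0\<close> for all \<open>x\<close> outside a set of small measure; then
  \<open>{x. (g x + t) mod N < r}\<close> is free up to that set, and averaging over \<open>t\<close> gives measure close to
  \<open>r / N\<close>. Such a \<open>g\<close> comes from a Rokhlin-type argument for the commuting endomorphisms
  \<open>x \<mapsto> c i x\<close>. By multiplicative independence the products of powers of the \<open>c i\<close> with exponents below
  \<open>n\<close> form a Foelner box \<open>S\<close>. For a piece \<open>B\<close> of small diameter the sets \<open>{x. k x \<in> B}\<close>, \<open>k \<in> S\<close>, are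
  almost disjoint, because \<open>k x = m x\<close> has measure zero for \<open>k \<noteq> m\<close>; they carry an equivariant
  labelling. Running greedily through a partition into such pieces covers almost everything.
\<close>

section \<open>Integer multiples and Haar measure\<close>

lemma int_multiple_0 [simp]: "int_multiple 0 x = 0"
  by (simp add: int_multiple_def)

lemma int_multiple_of_nat_Suc: "int_multiple (1 + int n) x = x + int_multiple (int n) x"
proof -
  have "nat (1 + int n) = Suc n" by simp
  then show ?thesis unfolding int_multiple_def by simp
qed

lemma int_multiple_minus_left: "int_multiple (- k) x = - int_multiple k x"
  by (cases "k = 0") (auto simp: int_multiple_def)

lemma int_multiple_plus_1: "int_multiple (k + 1) x = x + int_multiple k x"
proof (cases k)
  case (nonneg n)
  then show ?thesis using int_multiple_of_nat_Suc[of n x] by (simp add: add.commute)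
next
  case (neg n)
  have "int_multiple (k + 1) x = - int_multiple (int n) x"
    using neg int_multiple_minus_left[of "int n" x] by simp
  moreover have "int_multiple k x = - (x + int_multiple (int n) x)"
    using neg int_multiple_minus_left[of "1 + int n" x] int_multiple_of_nat_Suc[of n x] by simp
  ultimately show ?thesis by simp
qed

lemma int_multiple_1 [simp]: "int_multiple 1 x = x"
  using int_multiple_plus_1[of 0 x] by simp

lemma int_multiple_minus_1: "int_multiple (k - 1) x = int_multiple k x - x"
  using int_multiple_plus_1[of "k - 1" x] by simp

lemma int_multiple_add_left: "int_multiple (k + l) x = int_multiple k x + int_multiple l x"
proof (induction k rule: int_induct[where k = 0])
  case base then show ?case by simp
next
  case (step1 i)
  have "i + 1 + l = (i + l) + 1" by simp
  from arg_cong[OF this, of "\<lambda>k. int_multiple k x"]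
  show ?case using step1 by (simp only: int_multiple_plus_1) (simp add: add.assoc)
next
  case (step2 i)
  have "i - 1 + l = (i + l) - 1" by simp
  then show ?case using step2 by (simp only: int_multiple_minus_1) simp
qed

lemma int_multiple_add_right: "int_multiple k (x + y) = int_multiple k x + int_multiple k y"
  by (induction k rule: int_induct[where k = 0])
     (simp_all add: int_multiple_plus_1 int_multiple_minus_1)

lemma int_multiple_zero_right [simp]: "int_multiple k 0 = 0"
  by (induction k rule: int_induct[where k = 0])
     (simp_all add: int_multiple_plus_1 int_multiple_minus_1)

lemma int_multiple_diff_right: "int_multiple k (x - y) = int_multiple k x - int_multiple k y"
  using int_multiple_add_right[of k "x - y" y] by simp

lemma int_multiple_mult: "int_multiple (k * l) x = int_multiple k (int_multiple l x)"
proof (induction k rule: int_induct[where k = 0])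
  case base then show ?case by simp
next
  case (step1 i)
  have "(i + 1) * l = l + i * l" by (simp add: algebra_simps)
  then show ?case using step1
    by (simp only: int_multiple_plus_1[of i] int_multiple_add_left[of l])
next
  case (step2 i)
  have "(i - 1) * l = i * l + - l" by (simp add: algebra_simps)
  then show ?case
    using step2 by (simp only: int_multiple_minus_1 int_multiple_add_left int_multiple_minus_left) simp
qed

lemma continuous_int_multiple:
  "continuous_on UNIV (int_multiple k :: 'a::topological_ab_group_add \<Rightarrow> 'a)"
proof (induction k rule: int_induct[where k = 0])
  case base then show ?case by simp
next
  case (step1 i)
  then show ?case by (auto simp: int_multiple_plus_1[abs_def] intro!: continuous_intros)
next
  case (step2 i)
  then show ?case by (auto simp: int_multiple_minus_1[abs_def] intro!: continuous_intros)
qed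

lemma borel_measurable_int_multiple [measurable]:
  "(int_multiple k :: 'a::topological_ab_group_add \<Rightarrow> 'a) \<in> borel_measurable borel"
  by (intro borel_measurable_continuous_onI continuous_int_multiple)

lemma divisible_group_surj:
  assumes "divisible_group TYPE('a::ab_group_add)" "k \<noteq> 0"
  shows "\<exists>y::'a. int_multiple k y = x"
proof (cases "k > 0")
  case True
  then show ?thesis using assms by (auto simp: divisible_group_def)
next
  case False
  then have "- k > 0" using assms by simp
  then obtain y :: 'a where "int_multiple (- k) y = - x"
    using assms unfolding divisible_group_def by blast
  then show ?thesis by (auto simp: int_multiple_minus_left)
qed

section \<open>Invariance and uniqueness of the Haar probability measure\<close>

lemma vimage_translation:
  "(\<lambda>x. g + x) -` A = (\<lambda>x. - g + x) ` (A :: 'a::ab_group_add set)"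
proof (intro set_eqI iffI)
  fix x assume "x \<in> (\<lambda>x. g + x) -` A"
  then show "x \<in> (\<lambda>x. - g + x) ` A" by (intro image_eqI[of _ _ "g + x"]) auto
qed auto

lemma haar_probability_vimage:
  assumes "haar_probability M" "A \<in> sets borel"
  shows "emeasure M ((\<lambda>x. g + x) -` A) = emeasure M A"
proof -
  show ?thesis unfolding vimage_translation using assms unfolding haar_probability_def by blast
qed

text \<open>Fubini for the indicator of \<open>A\<close> at \<open>x + y\<close> under the product
  of \<open>M\<close> and \<open>N\<close>: by invariance the inner integral is constantly
  \<open>emeasure M A\<close> in one order and \<open>emeasure N A\<close> in the other. Second
  countability makes addition measurable for the product sigma-algebra.\<close>

lemma haar_probability_unique:
  fixes M N :: "'a::{second_countable_topology, topological_ab_group_add} measure"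
  assumes M: "haar_probability M" and N: "haar_probability N" and A: "A \<in> sets borel"
  shows "emeasure M A = emeasure N A"
proof -
  have [measurable_cong]: "sets M = sets borel" "sets N = sets borel"
    using M N by (auto simp: haar_probability_def)
  interpret M: prob_space M using M by (simp add: haar_probability_def)
  interpret N: prob_space N using N by (simp add: haar_probability_def)
  interpret P: pair_sigma_finite M N ..
  note A [measurable]
  have [simp]: "space M = UNIV" "space N = UNIV"
    using \<open>sets M = _\<close> \<open>sets N = _\<close> by (auto dest: sets_eq_imp_space_eq)
  have "(\<lambda>(x, y). x + y :: 'a) \<in> borel_measurable (borel \<Otimes>\<^sub>M borel)"
    unfolding borel_prod
    by (intro borel_measurable_continuous_onI) (auto simp: case_prod_beta intro!: continuous_intros)
  then have add [measurable]: "(\<lambda>(x, y). x + y :: 'a) \<in> borel_measurable (M \<Otimes>\<^sub>M N)"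
    by measurable
  have meas: "(\<lambda>(x, y). indicator A (x + y) :: ennreal) \<in> borel_measurable (M \<Otimes>\<^sub>M N)"
    using measurable_compose[OF add, of "indicator A :: _ \<Rightarrow> ennreal" borel] A
    by (simp add: case_prod_beta)
  have trans_set: "(\<lambda>x. y + x) -` A \<in> sets L" if "sets L = sets borel" for y L
  proof -
    have "(\<lambda>x. y + x) \<in> borel_measurable borel" by measurable
    from measurable_sets[OF this A] show ?thesis using that by simp
  qed
  note trans_set[OF \<open>sets M = _\<close>, simp] trans_set[OF \<open>sets N = _\<close>, simp]
  have "emeasure M A = (\<integral>\<^sup>+y. emeasure M ((\<lambda>x. y + x) -` A) \<partial>N)"
    using haar_probability_vimage[OF M A] by (simp add: N.emeasure_space_1[simplified])
  also have "\<dots> = (\<integral>\<^sup>+y. \<integral>\<^sup>+x. indicator A (x + y) \<partial>M \<partial>N)"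
    by (intro nn_integral_cong, subst nn_integral_indicator[OF trans_set[OF \<open>sets M = _\<close>], symmetric],
        intro nn_integral_cong) (simp add: indicator_def add.commute)
  also have "\<dots> = (\<integral>\<^sup>+x. \<integral>\<^sup>+y. indicator A (x + y) \<partial>N \<partial>M)"
    using P.Fubini'[OF meas] by simp
  also have "\<dots> = (\<integral>\<^sup>+x. emeasure N ((\<lambda>y. x + y) -` A) \<partial>M)"
    by (intro nn_integral_cong, subst nn_integral_indicator[OF trans_set[OF \<open>sets N = _\<close>], symmetric],
        intro nn_integral_cong) (simp add: indicator_def)
  also have "\<dots> = emeasure N A"
    using haar_probability_vimage[OF N A] by (simp add: M.emeasure_space_1[simplified])
  finally show ?thesis .
qed

text \<open>The push-forward of \<open>M\<close> under multiplication by \<open>k\<close> is again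
  invariant: by divisibility a translation by \<open>g\<close> lifts to a translation by some
  \<open>h\<close> with \<open>k h = g\<close>. Uniqueness then identifies it with
  \<open>M\<close>.\<close>

lemma haar_probability_int_multiple:
  fixes M :: "'a::{second_countable_topology, topological_ab_group_add} measure"
  assumes M: "haar_probability M" and div: "divisible_group TYPE('a)" and k: "k \<noteq> 0"
    and A: "A \<in> sets borel"
  shows "measure M (int_multiple k -` A) = measure M A"
proof -
  have sM [measurable_cong]: "sets M = sets borel" using M by (simp add: haar_probability_def)
  have [simp]: "space M = UNIV" using sets_eq_imp_space_eq[OF sM] by simp
  interpret M: prob_space M using M by (simp add: haar_probability_def)
  let ?T = "int_multiple k :: 'a \<Rightarrow> 'a"
  have T [measurable]: "?T \<in> measurable M borel" by measurable
  let ?N = "distr M borel ?T"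
  have "haar_probability ?N"
    unfolding haar_probability_def
  proof (intro conjI allI ballI)
    show "sets ?N = sets borel" by simp
    show "prob_space ?N" by (intro M.prob_space_distr T)
    fix g :: 'a and B :: "'a set" assume B: "B \<in> sets borel"
    obtain h where h: "?T h = g" using divisible_group_surj[OF div k] by blast
    have img: "(\<lambda>x. g + x) ` B = (\<lambda>x. - g + x) -` B" for g and B :: "'a set"
      using vimage_translation[of "- g" B] by simp
    have gB: "(\<lambda>x. g + x) ` B \<in> sets borel"
    proof -
      have "(\<lambda>x. - g + x) \<in> borel_measurable borel" by measurable
      from measurable_sets[OF this B] show ?thesis by (simp add: img)
    qed
    have "?T -` (\<lambda>x. g + x) ` B = (\<lambda>x. h + x) ` (?T -` B)" (is "_ = _ ` ?U")
      using h unfolding img[of h ?U]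
      by (auto simp: img int_multiple_diff_right)
    moreover have "?T -` B \<in> sets borel" using measurable_sets[OF T B] sM by simp
    ultimately show "emeasure ?N ((\<lambda>x. g + x) ` B) = emeasure ?N B"
      using M B gB by (simp add: emeasure_distr haar_probability_def)
  qed
  from haar_probability_unique[OF M this A] show ?thesis
    using A by (simp add: measure_def emeasure_distr)
qed

text \<open>If \<open>{0}\<close> had positive mass, every point would have the same mass and the
  group would be finite. In a finite divisible group multiplication by a nonzero integer is
  bijective, so the multiples of \<open>x\<close> would be pairwise distinct, which is
  absurd.\<close>

lemma haar_probability_singleton_null:
  fixes M :: "'a::{polish_space, topological_ab_group_add} measure"
  assumes M: "haar_probability M" and div: "divisible_group TYPE('a)" and "x \<noteq> (0::'a)"
  shows "measure M {0} = 0"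
proof (rule ccontr)
  have sM [measurable_cong]: "sets M = sets borel" using M by (simp add: haar_probability_def)
  have [simp]: "space M = UNIV" using sets_eq_imp_space_eq[OF sM] by simp
  interpret M: prob_space M using M by (simp add: haar_probability_def)
  assume nz: "measure M {0} \<noteq> 0"
  have pt: "measure M {y} = measure M {0}" for y
  proof -
    have "emeasure M ((\<lambda>x. y + x) ` {0}) = emeasure M {0}"
      using M borel_singleton[of "{}" "0::'a"] unfolding haar_probability_def by blast
    then show ?thesis by (simp add: measure_def)
  qed
  have card_bound: "real (card B) * measure M {0} \<le> 1" if "finite B" for B :: "'a set"
  proof -
    have "measure M B = (\<Sum>y\<in>B. measure M {y})"
      using that by (intro M.finite_measure_eq_sum_singleton) (auto simp: sM)
    also have "\<dots> = (\<Sum>y\<in>B. measure M {0})" by (intro sum.cong pt refl)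
    finally show ?thesis using M.prob_le_1[of B] by simp
  qed
  have "finite (UNIV :: 'a set)"
  proof (rule ccontr)
    assume inf: "infinite (UNIV :: 'a set)"
    obtain n :: nat where n: "real n * measure M {0} > 1"
      using nz reals_Archimedean3[of "measure M {0}"] zero_less_measure_iff by blast
    obtain B :: "'a set" where "finite B" "card B = n"
      using infinite_arbitrarily_large[OF inf] by blast
    then show False using card_bound n by fastforce
  qed
  moreover have "inj (\<lambda>n::nat. int_multiple (int n) x)"
  proof (rule injI, rule ccontr)
    fix m n :: nat assume eq: "int_multiple (int m) x = int_multiple (int n) x" and "m \<noteq> n"
    let ?T = "int_multiple (int m - int n) :: 'a \<Rightarrow> 'a"
    have "?T x = 0"
      using eq int_multiple_add_left[of "int m" "- int n" x]
      by (simp add: int_multiple_minus_left)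
    moreover have "?T 0 = 0" using int_multiple_add_right[of "int m - int n" "0::'a" 0] by simp
    moreover have "surj ?T"
    proof -
      have "int m - int n \<noteq> 0" using \<open>m \<noteq> n\<close> by simp
      from divisible_group_surj[OF div this] show ?thesis by (metis surjI surj_def)
    qed
    then have "inj ?T" using \<open>finite UNIV\<close> by (rule finite_UNIV_surj_inj[rotated])
    ultimately show False using \<open>x \<noteq> 0\<close> injD[of ?T x 0] by simp
  qed
  ultimately show False using finite_imageD[of _ "UNIV :: nat set"] finite_subset[OF subset_UNIV] by blast
qed

text \<open>The coincidence set is the kernel of multiplication by \<open>k - l\<close>, that is,
  the preimage of a null set.\<close>

lemma haar_probability_coincidence_null:
  fixes M :: "'a::{polish_space, topological_ab_group_add} measure"
  assumes M: "haar_probability M" and div: "divisible_group TYPE('a)" and "x0 \<noteq> (0::'a)"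
    and "k \<noteq> l"
  shows "measure M {x. int_multiple k x = int_multiple l x} = 0"
proof -
  have "{x. int_multiple k x = int_multiple l x} = int_multiple (k - l) -` {0::'a}"
    using int_multiple_add_left[of k "- l", where 'a = 'a] by (auto simp: int_multiple_minus_left)
  then show ?thesis
    using haar_probability_int_multiple[OF M div, of "k - l" "{0}"] \<open>k \<noteq> l\<close>
      haar_probability_singleton_null[OF M div \<open>x0 \<noteq> 0\<close>] by simp
qed

section \<open>Greedy tilings by towers\<close>

text \<open>Abstract setting of the Rokhlin-type argument. \<open>T\<close> is a measure-preserving
  action of the nonzero integers under multiplication, \<open>S\<close> a Foelner set with labelling
  \<open>l\<close> and Foelner ratio \<theta>, and \<open>B\<close> a partition into
  \<open>r\<close> pieces. Off the exceptional set \<open>D\<close> no two elements of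
  \<open>S\<close> send a point into the same piece. A tower has to bring new mass in proportion
  \<delta> to be accepted.\<close>

locale approximate_tiling = prob_space M for M :: "'a measure" +
  fixes T :: "int \<Rightarrow> 'a \<Rightarrow> 'a" and S :: "int set" and I :: "'i set" and c :: "'i \<Rightarrow> int"
    and a :: "'i \<Rightarrow> real" and l :: "int \<Rightarrow> real"
    and B :: "nat \<Rightarrow> 'a set" and r :: nat and D :: "'a set" and \<theta> \<delta> :: real
  assumes space_M: "space M = UNIV"
    and T_meas: "k \<noteq> 0 \<Longrightarrow> T k \<in> measurable M M"
    and T_pres: "k \<noteq> 0 \<Longrightarrow> A \<in> sets M \<Longrightarrow> measure M (T k -` A) = measure M A"
    and T_mult: "T (k * m) x = T k (T m x)"
    and S: "finite S" "S \<noteq> {}" "0 \<notin> S"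
    and I: "finite I" "\<And>i. i \<in> I \<Longrightarrow> c i \<noteq> 0"
    and label: "\<And>i k. i \<in> I \<Longrightarrow> k \<in> S \<Longrightarrow> c i * k \<in> S \<Longrightarrow> l (c i * k) = l k + a i"
    and foelner: "\<And>i. i \<in> I \<Longrightarrow>
      real (card (S - (*) (c i) ` S)) + real (card ((*) (c i) ` S - S)) \<le> \<theta> * real (card S)"
    and B: "\<And>j. B j \<in> sets M" "disjoint_family_on B {..<r}" "(\<Union>j<r. B j) = UNIV"
    and D: "D \<in> sets M"
      "\<And>x k m j. \<lbrakk>x \<notin> D; k \<in> S; m \<in> S; j < r; T k x \<in> B j; T m x \<in> B j\<rbrakk> \<Longrightarrow> k = m"
    and \<theta>\<delta>: "0 \<le> \<theta>" "0 < \<delta>"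
begin

lemma vimage_T [measurable]: "k \<noteq> 0 \<Longrightarrow> A \<in> sets M \<Longrightarrow> T k -` A \<in> sets M"
  using measurable_sets[OF T_meas] by (simp add: space_M)

definition tower :: "nat \<Rightarrow> 'a set" where
  "tower j = (\<Union>k\<in>S. T k -` B j)"

text \<open>Off \<open>D\<close> at most one summand is nonzero.\<close>

definition tower_label :: "nat \<Rightarrow> 'a \<Rightarrow> real" where
  "tower_label j x = (\<Sum>k\<in>S. - l k * indicator (T k -` B j) x)"

text \<open>The boundary of the tower in direction \<open>c i\<close>: for \<open>k\<close> in
  \<open>S\<close> but not a multiple \<open>c i * m\<close> with \<open>m\<close> in
  \<open>S\<close>, applying \<open>T (c i)\<close> may leave the tower; for
  \<open>k = c i * m\<close> outside \<open>S\<close>, it may enter the tower.\<close>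

definition face :: "'i \<Rightarrow> nat \<Rightarrow> 'a set" where
  "face i j = (\<Union>k\<in>(S - (*) (c i) ` S) \<union> ((*) (c i) ` S - S). T k -` B j)"

text \<open>Points that enter \<open>E\<close> from outside count as bad too. Otherwise labelling
  such a point later, as part of another tower, could break equivariance against the label its image
  already has.\<close>

definition bad :: "'i \<Rightarrow> 'a set \<Rightarrow> ('a \<Rightarrow> real) \<Rightarrow> 'a set" where
  "bad i E g = {x. \<not> (if x \<in> E then T (c i) x \<in> E \<and> g (T (c i) x) = g x + a i else T (c i) x \<notin> E)}"

lemma bad_measurable:
  assumes i: "i \<in> I" and [measurable]: "E \<in> sets M" "g \<in> borel_measurable M"
  shows "bad i E g \<in> sets M"
proof -
  have [measurable]: "T (c i) \<in> measurable M M" using T_meas I i by blast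
  have "bad i E g = {x\<in>space M. \<not> (if x \<in> E then T (c i) x \<in> E \<and> g (T (c i) x) = g x + a i
      else T (c i) x \<notin> E)}"
    by (simp add: bad_def space_M)
  also have "\<dots> \<in> sets M" by measurable
  finally show ?thesis .
qed

lemma tower_measurable [measurable]: "tower j \<in> sets M"
  unfolding tower_def using S B by (intro sets.finite_UN) (auto intro!: vimage_T)

lemma tower_label_measurable [measurable]: "tower_label j \<in> borel_measurable M"
  unfolding tower_label_def[abs_def] using S B
  by (intro borel_measurable_sum borel_measurable_times borel_measurable_const
      borel_measurable_indicator vimage_T) auto

lemma tower_label_eq:
  assumes "x \<notin> D" "k \<in> S" "j < r" "T k x \<in> B j"
  shows "tower_label j x = - l k"
proof -
  have "tower_label j x = (\<Sum>m\<in>S. if m = k then - l k else 0)"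
    unfolding tower_label_def
  proof (intro sum.cong refl)
    fix m assume "m \<in> S"
    then have "T m x \<in> B j \<longleftrightarrow> m = k"
      using D(2)[OF assms(1,2) \<open>m \<in> S\<close> assms(3,4)] assms(4) by blast
    then show "- l m * indicator (T m -` B j) x = (if m = k then - l k else 0)"
      by (cases "m = k") (simp_all add: indicator_def)
  qed
  then show ?thesis using S assms by simp
qed

text \<open>A union bound: each preimage has the measure of \<open>B j\<close>, and the Foelner
  condition bounds the number of preimages.\<close>

lemma measure_face:
  assumes "i \<in> I"
  shows "measure M (face i j) \<le> \<theta> * real (card S) * measure M (B j)"
proof -
  let ?K = "(S - (*) (c i) ` S) \<union> ((*) (c i) ` S - S)"
  have nz: "k \<noteq> 0" if "k \<in> ?K" for k using that S I assms by auto
  have "measure M (face i j) \<le> (\<Sum>k\<in>?K. measure M (T k -` B j))"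
    unfolding face_def using S nz B(1)
    by (intro finite_measure_subadditive_finite image_subsetI vimage_T) auto
  also have "\<dots> = (\<Sum>k\<in>?K. measure M (B j))"
    using nz B(1) by (intro sum.cong refl T_pres)
  also have "\<dots> = real (card ?K) * measure M (B j)" by simp
  also have "card ?K = card (S - (*) (c i) ` S) + card ((*) (c i) ` S - S)"
    using S by (intro card_Un_disjoint) auto
  also have "real \<dots> * measure M (B j) \<le> (\<theta> * real (card S)) * measure M (B j)"
    using foelner[OF assms] by (intro mult_right_mono) auto
  finally show ?thesis .
qed

lemma face_measurable: "i \<in> I \<Longrightarrow> face i j \<in> sets M"
  unfolding face_def using S I B by (intro sets.finite_UN) (auto intro!: vimage_T)

text \<open>A point that is not bad lies in \<open>E\<close> together with its image, where nothing
  changes, or outside \<open>E\<close> together with it. In the second case both are off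
  \<open>D\<close>, so tower labels are unambiguous, and equivariance can fail only by crossing the
  boundary of the tower.\<close>

lemma bad_extend:
  fixes g :: "'a \<Rightarrow> real"
  assumes i: "i \<in> I" and j: "j < r" and DE: "D \<subseteq> E"
  defines "g' \<equiv> \<lambda>x. if x \<in> E then g x else tower_label j x"
  shows "bad i (E \<union> tower j) g' \<subseteq> bad i E g \<union> face i j"
proof (rule subsetI, rule ccontr)
  fix x assume xb: "x \<in> bad i (E \<union> tower j) g'" and "x \<notin> bad i E g \<union> face i j"
  then have nb: "x \<notin> bad i E g" and nf: "x \<notin> face i j" by auto
  have comm: "T (c i * k) x = T k (T (c i) x)" for k
    using T_mult[of k "c i" x] by (simp add: mult.commute)
  show False
  proof (cases "x \<in> E")
    case True
    then show False using nb xb by (auto simp: bad_def g'_def split: if_splits)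
  next
    case False
    then have cx: "T (c i) x \<notin> E" using nb by (auto simp: bad_def)
    have xD: "x \<notin> D" "T (c i) x \<notin> D" using False cx DE by auto
    show False
    proof (cases "x \<in> tower j")
      case True
      then obtain k where k: "k \<in> S" "T k x \<in> B j" by (auto simp: tower_def)
      have "k \<in> (*) (c i) ` S" using nf k by (auto simp: face_def)
      then obtain m where m: "m \<in> S" "k = c i * m" by auto
      then have B': "T m (T (c i) x) \<in> B j" using k comm by simp
      have "tower_label j x = - l k" using tower_label_eq xD k j by blast
      moreover have "tower_label j (T (c i) x) = - l m" using tower_label_eq xD m B' j by blast
      moreover have "l k = l m + a i" using label i m k by auto
      moreover have "T (c i) x \<in> tower j" using m B' by (auto simp: tower_def)
      ultimately show False using xb True False cx by (auto simp: bad_def g'_def)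
    next
      case nt: False
      then have "T (c i) x \<in> tower j" using xb False cx by (auto simp: bad_def split: if_splits)
      then obtain k where k: "k \<in> S" "T k (T (c i) x) \<in> B j" by (auto simp: tower_def)
      then have kx: "T (c i * k) x \<in> B j" using comm by simp
      show False
      proof (cases "c i * k \<in> S")
        case True
        then show False using kx nt by (auto simp: tower_def)
      next
        case False
        then show False using kx nf k by (auto simp: face_def)
      qed
    qed
  qed
qed

text \<open>
  Greedy step: the tower over \<open>B j\<close> is added only if it captures at least the proportion \<open>\<delta>\<close> of
  new mass. Its face, the only place where new bad points can appear, is then at most \<open>\<theta> / \<delta>\<close>
  times the gained mass, so the faces stay small in total.
\<close>

lemma partial_labelling:
  "j \<le> r \<Longrightarrow> \<exists>E g. D \<subseteq> E \<and> E \<in> sets M \<and> g \<in> borel_measurable M \<and>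
     (\<forall>i\<in>I. measure M (bad i E g) \<le> 2 * measure M D + \<theta> / \<delta> * measure M E) \<and>
     (\<forall>u<j. measure M (tower u - E) \<le> \<delta> * real (card S) * measure M (B u))"
proof (induction j)
  case 0
  \<comment> \<open>Start with \<open>E = D\<close> and label 0: a point is bad only if it or its
    image lies in \<open>D\<close>, and each of these events has measure
    \<open>measure M D\<close>.\<close>
  have "measure M (bad i D (\<lambda>_. 0)) \<le> 2 * measure M D + \<theta> / \<delta> * measure M D" if i: "i \<in> I" for i
  proof -
    have "measure M (bad i D (\<lambda>_. 0)) \<le> measure M (D \<union> T (c i) -` D)"
      using i I D by (intro finite_measure_mono) (auto simp: bad_def split: if_splits)
    also have "\<dots> \<le> measure M D + measure M (T (c i) -` D)"
      using i I D by (intro measure_Un_le) auto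
    also have "measure M (T (c i) -` D) = measure M D" using i I D T_pres by auto
    finally show ?thesis using \<theta>\<delta> by (auto intro: order_trans)
  qed
  then show ?case using D by (intro exI[of _ D] exI[of _ "\<lambda>_. 0"]) auto
next
  case (Suc j)
  then obtain E g where DE: "D \<subseteq> E" and [measurable]: "E \<in> sets M" "g \<in> borel_measurable M"
    and bad: "\<And>i. i \<in> I \<Longrightarrow> measure M (bad i E g) \<le> 2 * measure M D + \<theta> / \<delta> * measure M E"
    and small: "\<And>u. u < j \<Longrightarrow> measure M (tower u - E) \<le> \<delta> * real (card S) * measure M (B u)"
    by auto
  show ?case
  proof (cases "measure M (tower j - E) \<le> \<delta> * real (card S) * measure M (B j)")
    case True
    then show ?thesis using DE bad small \<open>E \<in> sets M\<close> \<open>g \<in> borel_measurable M\<close>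
      by (intro exI[of _ E] exI[of _ g]) (auto simp: less_Suc_eq)
  next
    case False
    define E' where "E' = E \<union> tower j"
    define g' where "g' = (\<lambda>x. if x \<in> E then g x else tower_label j x)"
    have E' [measurable]: "E' \<in> sets M" unfolding E'_def by measurable
    have g': "g' \<in> borel_measurable M" unfolding g'_def by measurable
    have ME': "measure M E' = measure M E + measure M (tower j - E)"
    proof -
      have "E' = E \<union> (tower j - E)" unfolding E'_def by auto
      then show ?thesis using finite_measure_Union[of E "tower j - E"] by auto
    qed
    have "measure M (bad i E' g') \<le> 2 * measure M D + \<theta> / \<delta> * measure M E'" if i: "i \<in> I" for i
    proof -
      have "measure M (bad i E' g') \<le> measure M (bad i E g \<union> face i j)"
        using bad_extend[OF i _ DE, of j g] Suc.prems bad_measurable[OF i] face_measurable[OF i]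
        unfolding E'_def g'_def
        by (intro finite_measure_mono) auto
      also have "\<dots> \<le> measure M (bad i E g) + measure M (face i j)"
        using bad_measurable[OF i] face_measurable[OF i]
        by (intro measure_Un_le) auto
      also have "measure M (face i j) \<le> \<theta> * real (card S) * measure M (B j)"
        by (rule measure_face[OF i])
      also have "\<dots> = \<theta> / \<delta> * (\<delta> * real (card S) * measure M (B j))" using \<theta>\<delta> by simp
      also have "\<dots> \<le> \<theta> / \<delta> * measure M (tower j - E)"
        using False \<theta>\<delta> by (intro mult_left_mono) auto
      finally show ?thesis using bad[OF i] ME' by (simp add: algebra_simps)
    qed
    moreover have "measure M (tower u - E') \<le> \<delta> * real (card S) * measure M (B u)" if "u < Suc j" for u
    proof (cases "u = j")
      case True
      then have "tower u - E' = {}" by (auto simp: E'_def)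
      then show ?thesis using \<theta>\<delta> by (simp only: measure_empty) simp
    next
      case False
      have "measure M (tower u - E') \<le> measure M (tower u - E)"
        by (intro finite_measure_mono) (auto simp: E'_def)
      then show ?thesis using small[of u] that False by simp
    qed
    moreover have "D \<subseteq> E'" using DE by (auto simp: E'_def)
    ultimately show ?thesis using E' g' by (intro exI[of _ E'] exI[of _ g'] conjI ballI allI impI)
  qed
qed

text \<open>
  Since the \<open>B u\<close> partition the space, each \<open>T k\<close> spreads the uncovered set over all towers; a tower
  that was refused contributes little.
\<close>

lemma complement_small:
  assumes DE: "D \<subseteq> E" and [measurable]: "E \<in> sets M"
    and small: "\<And>u. u < r \<Longrightarrow> measure M (tower u - E) \<le> \<delta> * real (card S) * measure M (B u)"
  shows "measure M (UNIV - E) \<le> \<delta>"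
proof -
  have meas: "T k -` B u - E \<in> sets M" if "k \<in> S" for k u
    using that S B by (intro sets.Diff vimage_T) auto
  have sum_B: "(\<Sum>u<r. measure M (B u)) = 1"
    using finite_measure_finite_Union[of "{..<r}" B] B prob_space by (auto simp: space_M)
  have "real (card S) * measure M (UNIV - E) = (\<Sum>k\<in>S. measure M (UNIV - E))" by simp
  also have "\<dots> = (\<Sum>k\<in>S. \<Sum>u<r. measure M (T k -` B u - E))"
  proof (intro sum.cong refl)
    fix k assume k: "k \<in> S"
    have eq: "UNIV - E = (\<Union>u<r. T k -` B u - E)" using B(3) by blast
    have disj: "disjoint_family_on (\<lambda>u. T k -` B u - E) {..<r}"
      using B(2) by (auto simp: disjoint_family_on_def)
    show "measure M (UNIV - E) = (\<Sum>u<r. measure M (T k -` B u - E))"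
      unfolding eq
      by (rule finite_measure_finite_Union[OF finite_lessThan image_subsetI[OF meas[OF k]] disj])
  qed
  also have "\<dots> = (\<Sum>u<r. \<Sum>k\<in>S. measure M (T k -` B u - E))" by (rule sum.swap)
  also have "\<dots> = (\<Sum>u<r. measure M (tower u - E))"
  proof (intro sum.cong refl)
    fix u assume u: "u \<in> {..<r}"
    have eq: "tower u - E = (\<Union>k\<in>S. T k -` B u - E)" by (auto simp: tower_def)
    \<comment> \<open>Disjointness over \<open>k\<close> holds because \<open>E\<close> contains
      \<open>D\<close>; it turns the double count into a sum over towers.\<close>
    have disj: "disjoint_family_on (\<lambda>k. T k -` B u - E) S"
      unfolding disjoint_family_on_def
    proof (intro ballI impI equals0I)
      fix k m x assume "k \<in> S" "m \<in> S" "k \<noteq> m" and x: "x \<in> (T k -` B u - E) \<inter> (T m -` B u - E)"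
      then show False using D(2)[of x k m u] u DE by blast
    qed
    show "(\<Sum>k\<in>S. measure M (T k -` B u - E)) = measure M (tower u - E)"
      unfolding eq
      by (rule finite_measure_finite_Union[OF S(1) image_subsetI[OF meas] disj, symmetric])
  qed
  also have "\<dots> \<le> (\<Sum>u<r. \<delta> * real (card S) * measure M (B u))"
    using small by (intro sum_mono) auto
  also have "\<dots> = \<delta> * real (card S) * (\<Sum>u<r. measure M (B u))"
    by (simp add: sum_distrib_left)
  also have "\<dots> = real (card S) * \<delta>" by (simp add: sum_B)
  finally show ?thesis using S by (simp add: card_gt_0_iff)
qed

text \<open>After all \<open>r\<close> pieces have been processed, \<open>G\<close> is
  \<open>E\<close> without its bad points. The complement of \<open>E\<close> costs \<delta>, and
  each \<open>i\<close> costs its bad set, bounded using \<open>measure M E \<le> 1\<close>.\<close>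

lemma approximate_equivariance:
  "\<exists>G g. G \<in> sets M \<and> g \<in> borel_measurable M \<and>
     measure M G \<ge> 1 - \<delta> - real (card I) * (2 * measure M D + \<theta> / \<delta>) \<and>
     (\<forall>x\<in>G. \<forall>i\<in>I. g (T (c i) x) = g x + a i)"
proof -
  obtain E g where DE: "D \<subseteq> E" and E [measurable]: "E \<in> sets M" and g: "g \<in> borel_measurable M"
    and bad: "\<And>i. i \<in> I \<Longrightarrow> measure M (bad i E g) \<le> 2 * measure M D + \<theta> / \<delta> * measure M E"
    and small: "\<And>u. u < r \<Longrightarrow> measure M (tower u - E) \<le> \<delta> * real (card S) * measure M (B u)"
    using partial_labelling[of r] by auto
  define G where "G = E - (\<Union>i\<in>I. bad i E g)"
  have badm: "i \<in> I \<Longrightarrow> bad i E g \<in> sets M" for i using bad_measurable E g by blast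
  have UN: "(\<Union>i\<in>I. bad i E g) \<in> sets M" using I badm by (intro sets.finite_UN) auto
  have G: "G \<in> sets M" unfolding G_def using UN by auto
  have "measure M (UNIV - G) \<le> measure M ((UNIV - E) \<union> (\<Union>i\<in>I. bad i E g))"
    using UN E sets.compl_sets[OF E] by (intro finite_measure_mono) (auto simp: G_def space_M)
  also have "\<dots> \<le> measure M (UNIV - E) + measure M (\<Union>i\<in>I. bad i E g)"
    using UN sets.compl_sets[OF E] by (intro measure_Un_le) (auto simp: space_M)
  also have "measure M (\<Union>i\<in>I. bad i E g) \<le> (\<Sum>i\<in>I. measure M (bad i E g))"
    using I badm by (intro finite_measure_subadditive_finite) auto
  also have "\<dots> \<le> (\<Sum>i\<in>I. 2 * measure M D + \<theta> / \<delta>)"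
  proof (intro sum_mono)
    fix i assume "i \<in> I"
    have "\<theta> / \<delta> * measure M E \<le> \<theta> / \<delta> * 1"
      using \<theta>\<delta> by (intro mult_left_mono) auto
    then show "measure M (bad i E g) \<le> 2 * measure M D + \<theta> / \<delta>"
      using bad[OF \<open>i \<in> I\<close>] by simp
  qed
  also have "measure M (UNIV - E) \<le> \<delta>" using complement_small[OF DE E small] .
  finally have "measure M (UNIV - G) \<le> \<delta> + real (card I) * (2 * measure M D + \<theta> / \<delta>)" by simp
  moreover have "measure M (UNIV - G) = 1 - measure M G"
    using prob_compl[OF G] by (simp add: space_M)
  moreover have "\<forall>x\<in>G. \<forall>i\<in>I. g (T (c i) x) = g x + a i"
    by (auto simp: G_def bad_def)
  ultimately show ?thesis using G g by (intro exI[of _ G] exI[of _ g]) auto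
qed

end

section \<open>Foelner boxes, circle intervals and finite families of events\<close>

text \<open>The quotient of two equal products is a relation with exponents
  \<open>m i - m' i\<close>, so all of these vanish. \<open>PiE\<close> fixes the values outside
  \<open>J\<close>, so that equality on \<open>J\<close> is equality of functions.\<close>

lemma multiplicatively_independent_inj:
  fixes c :: "'i \<Rightarrow> int"
  assumes ind: "multiplicatively_independent J c" and J: "finite J" "\<And>i. i \<in> J \<Longrightarrow> c i \<noteq> 0"
  shows "inj_on (\<lambda>m. \<Prod>i\<in>J. c i ^ m i) (PiE J (\<lambda>_. UNIV :: nat set))"
proof (rule inj_onI)
  fix m m' assume m: "m \<in> PiE J (\<lambda>_. UNIV :: nat set)" and m': "m' \<in> PiE J (\<lambda>_. UNIV :: nat set)"
    and eq: "(\<Prod>i\<in>J. c i ^ m i) = (\<Prod>i\<in>J. c i ^ m' i)"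
  let ?c = "\<lambda>i. of_int (c i) :: rat"
  have "(\<Prod>i\<in>J. ?c i powi (int (m i) - int (m' i))) = (\<Prod>i\<in>J. ?c i ^ m i / ?c i ^ m' i)"
    using J by (intro prod.cong) (auto simp: power_int_diff)
  also have "\<dots> = of_int (\<Prod>i\<in>J. c i ^ m i) / of_int (\<Prod>i\<in>J. c i ^ m' i)"
    by (simp add: prod_dividef)
  also have "\<dots> = 1" unfolding eq using J by simp
  finally have "\<forall>i\<in>J. int (m i) - int (m' i) = 0"
    using ind[unfolded multiplicatively_independent_def, THEN spec[of _ "\<lambda>i. int (m i) - int (m' i)"]]
    by blast
  then show "m = m'" using m m' by (intro PiE_ext[OF m m']) auto
qed

text \<open>\<open>S\<close> is the image of the exponent box with side \<open>n\<close>.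
  Multiplication by \<open>c i\<close> raises the exponent of \<open>c i\<close> by one, so it
  pushes only the top layer, one \<open>n\<close>-th of the box, out of \<open>S\<close>, and it
  raises the \<open>a\<close>-weighted exponent sum \<open>l\<close> by \<open>a i\<close>.\<close>

lemma multiplicative_foelner_box:
  fixes c :: "'i \<Rightarrow> int" and a :: "'i \<Rightarrow> real"
  assumes ind: "multiplicatively_independent J c" and J: "finite J" "\<And>i. i \<in> J \<Longrightarrow> c i \<noteq> 0"
    and n: "0 < n"
  shows "\<exists>S l. finite S \<and> S \<noteq> {} \<and> 0 \<notin> S \<and>
    (\<forall>i\<in>J. \<forall>k\<in>S. l (c i * k) = l k + a i) \<and>
    (\<forall>i\<in>J. real (card (S - (*) (c i) ` S)) + real (card ((*) (c i) ` S - S))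
       \<le> 2 / real n * real (card S))"
proof -
  define P where "P m = (\<Prod>i\<in>J. c i ^ m i)" for m :: "'i \<Rightarrow> nat"
  define X where "X = PiE J (\<lambda>_. UNIV :: nat set)"
  define K where "K = PiE J (\<lambda>_. {..<n})"
  \<comment> \<open>Exponents are read off on all of \<open>X\<close>, not only on the box
    \<open>K\<close>, so that \<open>c i * k\<close> has the right label even when it leaves
    \<open>S\<close>.\<close>
  define l where "l k = (\<Sum>i\<in>J. a i * real (inv_into X P k i))" for k
  define S where "S = P ` K"
  have inj: "inj_on P X" unfolding P_def X_def by (rule multiplicatively_independent_inj[OF ind J])
  have KX: "K \<subseteq> X" unfolding K_def X_def by (auto simp: PiE_iff)
  have finK: "finite K" unfolding K_def using J by (intro finite_PiE) auto
  have finS: "finite S" unfolding S_def using finK by simp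
  have cardK: "card K = n ^ card J" unfolding K_def using J by (simp add: card_PiE)
  have cardS: "card S = n ^ card J"
    unfolding S_def using card_image[OF inj_on_subset[OF inj KX]] cardK by simp
  have lP: "l (P m) = (\<Sum>i\<in>J. a i * real (m i))" if "m \<in> X" for m
    unfolding l_def using inv_into_f_f[OF inj that] by simp
  have shift: "c i * P m = P (m(i := Suc (m i)))" if "i \<in> J" for i m
  proof -
    have "(\<Prod>j\<in>J - {i}. c j ^ (m(i := Suc (m i))) j) = (\<Prod>j\<in>J - {i}. c j ^ m j)"
      by (intro prod.cong) auto
    then show ?thesis
      unfolding P_def using prod.remove[OF J(1) that, of "\<lambda>j. c j ^ m j"]
        prod.remove[OF J(1) that, of "\<lambda>j. c j ^ (m(i := Suc (m i))) j"] by simp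
  qed
  have shiftX: "m(i := Suc (m i)) \<in> X" if "i \<in> J" "m \<in> X" for i m
    using that unfolding X_def by (auto simp: PiE_iff extensional_def)
  have label: "l (c i * k) = l k + a i" if i: "i \<in> J" and k: "k \<in> S" for i k
  proof -
    obtain m where m: "m \<in> X" "k = P m" using k KX by (auto simp: S_def)
    have "(\<Sum>j\<in>J - {i}. a j * real ((m(i := Suc (m i))) j)) = (\<Sum>j\<in>J - {i}. a j * real (m j))"
      by (intro sum.cong) auto
    then have "(\<Sum>j\<in>J. a j * real ((m(i := Suc (m i))) j)) = (\<Sum>j\<in>J. a j * real (m j)) + a i"
      using sum.remove[OF J(1) i, of "\<lambda>j. a j * real (m j)"]
        sum.remove[OF J(1) i, of "\<lambda>j. a j * real ((m(i := Suc (m i))) j)"]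
      by (simp add: algebra_simps)
    then show ?thesis using m lP[OF m(1)] lP[OF shiftX[OF i m(1)]] shift[OF i] by simp
  qed
  have bound: "real (card (S - (*) (c i) ` S)) + real (card ((*) (c i) ` S - S))
       \<le> 2 / real n * real (card S)" if i: "i \<in> J" for i
  proof -
    let ?cS = "(*) (c i) ` S"
    \<comment> \<open>The top layer of the box in direction \<open>i\<close>: the exponents for
      which the shift by one leaves the box.\<close>
    define Z where "Z = PiE J (\<lambda>j. if j = i then {n - 1} else {..<n})"
    have finZ: "finite Z" unfolding Z_def using J by (intro finite_PiE) auto
    have "card Z = (\<Prod>j\<in>J. if j = i then 1 else n)"
      unfolding Z_def using J by (simp add: card_PiE if_distrib cong: if_cong)
    also have "\<dots> = n ^ (card J - 1)"
      using prod.remove[OF J(1) i, of "\<lambda>j. if j = i then 1 else n"] J i by simp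
    finally have "n * card Z = n ^ card J"
      using J i by (metis card_gt_0_iff empty_iff power_eq_if not_gr_zero)
    then have nZ: "real (card Z) = real (card S) / real n"
      using n cardS by (simp add: field_simps flip: of_nat_mult of_nat_power)
    have "?cS - S \<subseteq> (\<lambda>m. c i * P m) ` Z"
    proof
      fix k assume k: "k \<in> ?cS - S"
      then obtain m where m: "m \<in> K" "k = c i * P m" by (auto simp: S_def)
      have "m i < n" using m i by (auto simp: K_def)
      have "m i = n - 1"
      proof (rule ccontr)
        assume "m i \<noteq> n - 1"
        then have "m(i := Suc (m i)) \<in> K"
          using m i \<open>m i < n\<close> by (auto simp: K_def PiE_iff extensional_def)
        then have "k \<in> S" using m shift[OF i] by (auto simp: S_def)
        then show False using k by simp
      qed
      then have "m \<in> Z" using m by (auto simp: Z_def K_def PiE_iff)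
      then show "k \<in> (\<lambda>m. c i * P m) ` Z" using m by auto
    qed
    then have le: "card (?cS - S) \<le> card Z"
      using finZ by (meson card_image_le card_mono finite_imageI le_trans)
    \<comment> \<open>Multiplication by \<open>c i\<close> is injective, so both halves of the
      symmetric difference have the same size and one estimate serves for both.\<close>
    have "card ?cS = card S" using J(2)[OF i] by (intro card_image) (auto simp: inj_on_def)
    then have "card (S - ?cS) = card (?cS - S)"
      using card_Diff_subset_Int[of S ?cS] card_Diff_subset_Int[of ?cS S] finS
      by (simp add: Int_commute)
    moreover have "real (card (?cS - S)) \<le> real (card S) / real n"
      using le unfolding nZ[symmetric] by simp
    ultimately show ?thesis by simp
  qed
  have "K \<noteq> {}" unfolding K_def using n by (auto simp: PiE_eq_empty_iff)
  moreover have "0 \<notin> S" unfolding S_def P_def using J by auto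
  ultimately show ?thesis using finS label bound
    by (intro exI[of _ S] exI[of _ l]) (auto simp: S_def)
qed

section \<open>Intervals of the circle and discretization of circular colourings\<close>

lemma measure_frac_image_le:
  assumes "a < b"
  shows "measure lebesgue (frac ` {a<..<b}) \<le> b - a"
proof -
  \<comment> \<open>A non-measurable set has \<open>measure\<close> 0 by convention, so the bound
    holds for it as well.\<close>
  have le1: "measure lebesgue X \<le> y - x" if "X \<subseteq> {x..y}" "x \<le> y" for X and x y :: real
  proof (cases "X \<in> sets lebesgue")
    case True
    then have "measure lebesgue X \<le> measure lebesgue {x..y}"
      using that by (intro measure_mono_fmeasurable) auto
    then show ?thesis using that by simp
  qed (use that in \<open>simp add: measure_notin_sets\<close>)
  \<comment> \<open>Either the interval is long enough for the trivial bound 1, or it crosses no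
    integer, or it crosses exactly one and wraps around into two pieces.\<close>
  consider "b - a \<ge> 1" | "b \<le> of_int \<lfloor>a\<rfloor> + 1" | "b - a < 1" "b > of_int \<lfloor>a\<rfloor> + 1" by linarith
  then show ?thesis
  proof cases
    case 1
    have "frac ` {a<..<b} \<subseteq> {0..1}" by (auto simp: frac_ge_0 less_imp_le[OF frac_lt_1])
    from le1[OF this] 1 show ?thesis by simp
  next
    case 2
    have "frac x \<in> {a - of_int \<lfloor>a\<rfloor>..b - of_int \<lfloor>a\<rfloor>}" if "x \<in> {a<..<b}" for x
    proof -
      have "\<lfloor>x\<rfloor> = \<lfloor>a\<rfloor>" using that 2 by (intro floor_unique) (auto, linarith+)
      then show ?thesis using that by (auto simp: frac_def)
    qed
    then have "frac ` {a<..<b} \<subseteq> {a - of_int \<lfloor>a\<rfloor>..b - of_int \<lfloor>a\<rfloor>}" by blast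
    from le1[OF this] show ?thesis using assms by simp
  next
    case 3
    let ?X = "{a - of_int \<lfloor>a\<rfloor>..1}" and ?Y = "{0..b - of_int \<lfloor>a\<rfloor> - 1}"
    have "frac x \<in> ?X \<union> ?Y" if x: "x \<in> {a<..<b}" for x
    proof (cases "x < of_int \<lfloor>a\<rfloor> + 1")
      case True
      have "\<lfloor>x\<rfloor> = \<lfloor>a\<rfloor>" using x True by (intro floor_unique) (auto, linarith+)
      then show ?thesis using x True by (auto simp: frac_def)
    next
      case False
      have "\<lfloor>x\<rfloor> = \<lfloor>a\<rfloor> + 1" using x 3 False by (intro floor_unique) (auto, linarith+)
      then show ?thesis using x False by (auto simp: frac_def)
    qed
    then have sub: "frac ` {a<..<b} \<subseteq> ?X \<union> ?Y" by blast
    show ?thesis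
    proof (cases "frac ` {a<..<b} \<in> sets lebesgue")
      case True
      then have "measure lebesgue (frac ` {a<..<b}) \<le> measure lebesgue (?X \<union> ?Y)"
        using sub by (intro measure_mono_fmeasurable) (auto intro!: fmeasurable.Un)
      also have "\<dots> \<le> measure lebesgue ?X + measure lebesgue ?Y" by (intro measure_Un_le) auto
      also have "\<dots> = b - a" using 3 by (simp, linarith)
      finally show ?thesis .
    qed (use assms in \<open>simp add: measure_notin_sets\<close>)
  qed
qed

lemma measure_circle_open_interval_le_1:
  assumes "circle_open_interval A"
  shows "measure lebesgue A \<le> 1"
proof (cases "A \<in> sets lebesgue")
  case True
  have "A \<subseteq> {0..1}" using assms
    by (auto simp: circle_open_interval_def frac_ge_0 less_imp_le[OF frac_lt_1])
  then have "measure lebesgue A \<le> measure lebesgue {0..1::real}"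
    using True by (intro measure_mono_fmeasurable) auto
  then show ?thesis by simp
qed (simp add: measure_notin_sets)

text \<open>The interval of the line that represents \<open>A\<close> has length at least
  \<open>p\<close>. Scaled by \<open>N\<close> it is longer than \<open>r\<close>, so it contains
  the \<open>r\<close> consecutive integers that start at the first integer beyond its left
  end.\<close>

lemma circle_interval_grid_points:
  assumes A: "circle_open_interval A" and p: "measure lebesgue A = p"
    and N: "0 < N" "real r < real N * p"
  shows "\<exists>a::int. \<forall>s. 0 \<le> s \<and> s < int r \<longrightarrow> frac (real_of_int (a + s) / real N) \<in> A"
proof -
  obtain x y where xy: "x < y" "A = frac ` {x<..<y}" using A by (auto simp: circle_open_interval_def)
  have "p \<le> y - x" using measure_frac_image_le[OF xy(1)] xy p by simp
  then have "real N * p \<le> real N * (y - x)" using N by simp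
  then have r: "real r < real N * y - real N * x" using N by (simp add: algebra_simps)
  have "real_of_int (\<lfloor>real N * x\<rfloor> + 1 + s) / real N \<in> {x<..<y}" if s: "0 \<le> s" "s < int r" for s
  proof -
    have "real_of_int s \<le> real r - 1" using s by linarith
    then have "real_of_int (\<lfloor>real N * x\<rfloor> + 1 + s) < real N * y"
      using r by linarith
    moreover have "real_of_int (\<lfloor>real N * x\<rfloor> + 1 + s) > real N * x" using s by linarith
    ultimately show ?thesis using N by (simp add: field_simps)
  qed
  then show ?thesis unfolding xy(2) by (intro exI[of _ "\<lfloor>real N * x\<rfloor> + 1"]) blast
qed

lemma frac_div_eq_if_mod_eq:
  assumes "0 < N" "(a::int) mod int N = b mod int N"
  shows "frac (real_of_int a / real N) = frac (real_of_int b / real N)"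
proof -
  obtain t where "a = b + int N * t" using assms(2) by (metis mod_eqE add.commute)
  then have "real_of_int a / real N = real_of_int b / real N + of_int t"
    using assms(1) by (simp add: field_simps)
  then show ?thesis by (simp add: frac_def)
qed

text \<open>Each interval contains \<open>r\<close> consecutive points of the grid with step
  \<open>1 / N\<close>. Equal residues modulo \<open>N\<close> give the same point of the circle, so
  a collision along an edge would put a point into two disjoint intervals.\<close>

lemma circular_colouring_discretization:
  assumes A: "\<forall>v\<in>V. circle_open_interval (A v) \<and> measure lebesgue (A v) = p"
    and E: "E \<subseteq> V \<times> V" "\<forall>(u, v)\<in>E. A u \<inter> A v = {}"
    and p: "0 < p" and e: "0 < e"
  shows "\<exists>(N::nat) (r::nat) a. 0 < N \<and> real r < real N * p \<and> p - e \<le> real r / real N \<and>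
    (\<forall>(u, v)\<in>E. \<forall>s t. 0 \<le> s \<and> s < int r \<and> 0 \<le> t \<and> t < int r \<longrightarrow>
       (a u + s) mod int N \<noteq> (a v + t) mod int N)"
proof -
  obtain N :: nat where N: "0 < N" "1 / e < real N"
    by (metis reals_Archimedean2 gr0I order.asym of_nat_0 zero_less_divide_1_iff e)
  \<comment> \<open>The largest integer strictly below \<open>N * p\<close>; rounding loses at most
    \<open>1 / N\<close>, which is less than \<open>e\<close>.\<close>
  define r where "r = nat (\<lceil>real N * p\<rceil> - 1)"
  have "0 < real N * p" using N p by simp
  then have r: "real r < real N * p" "real N * p - 1 \<le> real r"
    unfolding r_def by linarith+
  have "p - e \<le> real r / real N"
  proof -
    have "1 < e * real N" using N e by (simp add: field_simps)
    then have "(p - e) * real N \<le> real r" using r by (simp add: algebra_simps)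
    then show ?thesis using N by (simp add: field_simps)
  qed
  moreover have "\<exists>a. \<forall>v\<in>V. \<forall>s. 0 \<le> s \<and> s < int r \<longrightarrow> frac (real_of_int (a v + s) / real N) \<in> A v"
    using circle_interval_grid_points[OF conjunct1[OF bspec[OF A]] conjunct2[OF bspec[OF A]] N(1) r(1)]
    by (intro bchoice) blast
  then obtain a where
    a: "\<And>v s. v \<in> V \<Longrightarrow> 0 \<le> s \<Longrightarrow> s < int r \<Longrightarrow> frac (real_of_int (a v + s) / real N) \<in> A v"
    by blast
  have "(a u + s) mod int N \<noteq> (a v + t) mod int N"
    if "(u, v) \<in> E" "0 \<le> s" "s < int r" "0 \<le> t" "t < int r" for u v s t
  proof
    assume "(a u + s) mod int N = (a v + t) mod int N"
    from frac_div_eq_if_mod_eq[OF N(1) this]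
    have "frac (real_of_int (a u + s) / real N) \<in> A u \<inter> A v"
      using a[of u s] a[of v t] that E(1) by auto
    then show False using E(2) that by blast
  qed
  ultimately show ?thesis using N r by (intro exI[of _ N] exI[of _ r] exI[of _ a]) auto
qed

text \<open>The atoms \<open>X P\<close> of the finite algebra generated by the events are laid out
  in \<open>{0..<1}\<close> as consecutive half-open intervals \<open>I k\<close> of the same
  measures; \<open>A v\<close> collects the intervals whose atoms lie in \<open>B v\<close>.\<close>

lemma events_realized_in_unit_interval:
  assumes "prob_space M" and V: "finite V" and B: "\<And>v. v \<in> V \<Longrightarrow> B v \<in> sets M"
  shows "\<exists>A :: 'v \<Rightarrow> real set.
    (\<forall>v\<in>V. A v \<subseteq> {0..<1} \<and> A v \<in> sets lebesgue \<and> measure lebesgue (A v) = measure M (B v)) \<and>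
    (\<forall>u v. u \<in> V \<and> v \<in> V \<and> B u \<inter> B v = {} \<longrightarrow> A u \<inter> A v = {})"
proof -
  interpret prob_space M by fact
  define X where "X P = {x\<in>space M. \<forall>v\<in>V. x \<in> B v \<longleftrightarrow> v \<in> P}" for P
  have X_meas: "X P \<in> sets M" for P
  proof -
    have "{x\<in>space M. x \<in> B v \<longleftrightarrow> v \<in> P} \<in> sets M" if v: "v \<in> V" for v
    proof -
      have "{x\<in>space M. x \<in> B v \<longleftrightarrow> v \<in> P} = (if v \<in> P then B v else space M - B v)"
        using sets.sets_into_space[OF B[OF v]] by auto
      then show ?thesis using B[OF v] by simp
    qed
    then show ?thesis unfolding X_def using V by (intro sets.sets_Collect_finite_All)
  qed
  obtain h where h: "bij_betw h {..<card (Pow V)} (Pow V)"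
    using ex_bij_betw_nat_finite[of "Pow V"] V by (auto simp: atLeast0LessThan)
  define n where "n = card (Pow V)"
  define w where "w k = measure M (X (h k))" for k
  define W where "W k = (\<Sum>j<k. w j)" for k
  have X_disj: "disjoint_family_on (\<lambda>k. X (h k)) {..<n}"
  proof (unfold disjoint_family_on_def, intro ballI impI equals0I)
    fix i j x assume ij: "i \<in> {..<n}" "j \<in> {..<n}" "i \<noteq> j" and "x \<in> X (h i) \<inter> X (h j)"
    then have "\<And>v. v \<in> V \<Longrightarrow> v \<in> h i \<longleftrightarrow> v \<in> h j" by (auto simp: X_def)
    moreover have "h i \<subseteq> V" "h j \<subseteq> V" using ij h by (auto simp: bij_betw_def n_def)
    ultimately have "h i = h j" by blast
    then show False using ij h by (auto simp: bij_betw_def n_def inj_on_def)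
  qed
  have W_mono: "W i \<le> W j" if "i \<le> j" for i j
    unfolding W_def using that by (intro sum_mono2) (auto simp: w_def)
  have W_Suc: "W (Suc k) = W k + w k" for k by (simp add: W_def)
  have "W n \<le> 1"
  proof -
    have "W n = measure M (\<Union>k<n. X (h k))"
      unfolding W_def w_def using X_meas X_disj by (intro finite_measure_finite_Union[symmetric]) auto
    then show ?thesis by simp
  qed
  define I where "I k = {W k..<W (Suc k)}" for k
  have I_disj: "disjoint_family_on I K" for K
  proof (unfold disjoint_family_on_def, intro ballI impI equals0I)
    fix i j x assume "i \<noteq> j" and x: "x \<in> I i \<inter> I j"
    then consider "Suc i \<le> j" | "Suc j \<le> i" by linarith
    then show False
    proof cases
      case 1
      from W_mono[OF this] x show False by (simp add: I_def)
    next
      case 2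
      from W_mono[OF this] x show False by (simp add: I_def)
    qed
  qed
  have I_meas: "I k \<in> lmeasurable" for k
    unfolding I_def by (intro bounded_set_imp_lmeasurable) auto
  \<comment> \<open>Only nonempty atoms are kept, so that an interval shared by \<open>A u\<close>
    and \<open>A v\<close> yields an actual point of \<open>B u \<inter> B v\<close>.\<close>
  define K where "K v = {k. k < n \<and> v \<in> h k \<and> X (h k) \<noteq> {}}" for v
  have finK: "finite (K v)" for v by (simp add: K_def)
  define A where "A v = (\<Union>k\<in>K v. I k)" for v
  have "A v \<subseteq> {0..<1}" for v
  proof
    fix x assume "x \<in> A v"
    then obtain k where k: "k < n" "W k \<le> x" "x < W (Suc k)" by (auto simp: A_def K_def I_def)
    have "W 0 = 0" by (simp add: W_def)
    then show "x \<in> {0..<1}" using W_mono[of 0 k] W_mono[of "Suc k" n] k \<open>W n \<le> 1\<close> by auto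
  qed
  moreover have "A v \<in> sets lebesgue" for v
    unfolding A_def I_def using finK by (intro sets.finite_UN) auto
  moreover have "measure lebesgue (A v) = measure M (B v)" if v: "v \<in> V" for v
  proof -
    have "measure lebesgue (A v) = (\<Sum>k\<in>K v. measure lebesgue (I k))"
      unfolding A_def
      by (rule measure_finite_Union[OF finK image_subsetI I_disj])
         (simp_all only: infinity_ennreal_def fmeasurableD[OF I_meas] fmeasurableD2[OF I_meas] not_False_eq_True)
    also have "\<dots> = (\<Sum>k\<in>K v. measure M (X (h k)))"
      by (intro sum.cong) (auto simp: I_def W_Suc w_def)
    also have "\<dots> = measure M (\<Union>k\<in>K v. X (h k))"
    proof (intro finite_measure_finite_Union[symmetric] finK image_subsetI X_meas)
      have "K v \<subseteq> {..<n}" by (auto simp: K_def)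
      then show "disjoint_family_on (\<lambda>k. X (h k)) (K v)"
        using X_disj by (rule disjoint_family_on_mono)
    qed
    also have "(\<Union>k\<in>K v. X (h k)) = B v"
    proof (intro equalityI subsetI)
      fix x assume "x \<in> (\<Union>k\<in>K v. X (h k))"
      then show "x \<in> B v" using v by (auto simp: K_def X_def)
    next
      fix x assume x: "x \<in> B v"
      let ?P = "{u\<in>V. x \<in> B u}"
      have "?P \<in> h ` {..<n}" using h by (simp add: bij_betw_def n_def)
      then obtain k where k: "k < n" "h k = ?P" by auto
      have "x \<in> space M" using x sets.sets_into_space[OF B[OF v]] by blast
      then have xX: "x \<in> X (h k)" unfolding X_def k(2) by blast
      have "v \<in> h k" unfolding k(2) using v x by blast
      then have "k \<in> K v" using k(1) xX unfolding K_def by blast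
      with xX show "x \<in> (\<Union>k\<in>K v. X (h k))" by blast
    qed
    finally show ?thesis .
  qed
  moreover have "A u \<inter> A v = {}" if uv: "u \<in> V" "v \<in> V" "B u \<inter> B v = {}" for u v
  proof (rule equals0I)
    fix x assume "x \<in> A u \<inter> A v"
    then obtain i j where ij: "i \<in> K u" "x \<in> I i" "j \<in> K v" "x \<in> I j" by (auto simp: A_def)
    have "i = j"
    proof (rule ccontr)
      assume "i \<noteq> j"
      with I_disj[of UNIV] have "I i \<inter> I j = {}" unfolding disjoint_family_on_def by blast
      then show False using ij by blast
    qed
    then have h: "v \<in> h i" "u \<in> h i" "X (h i) \<noteq> {}" using ij unfolding K_def by blast+
    then obtain y where "y \<in> X (h i)" by blast
    then have "y \<in> B u \<inter> B v" using h uv(1,2) unfolding X_def by blast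
    then show False using uv(3) by blast
  qed
  ultimately show ?thesis by (intro exI[of _ A]) blast
qed

section \<open>Approximately equivariant maps\<close>

text \<open>Compactness gives a finite cover by balls of radius \<open>e / 2\<close>, which is then
  made disjoint.\<close>

lemma small_diameter_partition:
  fixes e :: real
  assumes "compact (UNIV :: 'a::metric_space set)" "0 < e"
  shows "\<exists>(B :: nat \<Rightarrow> 'a set) r. (\<forall>j. B j \<in> sets borel) \<and> disjoint_family_on B {..<r} \<and>
    (\<Union>j<r. B j) = UNIV \<and> (\<forall>j. \<forall>x\<in>B j. \<forall>y\<in>B j. dist x y < e)"
proof -
  have "e / 2 > 0" using assms by simp
  then obtain X :: "'a set" where X: "finite X" "UNIV \<subseteq> (\<Union>x\<in>X. ball x (e / 2))"
    using assms(1) unfolding compact_eq_totally_bounded by meson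
  obtain h where "bij_betw h {0..<card X} X" using ex_bij_betw_nat_finite[OF X(1)] ..
  then have h: "h ` {..<card X} = X" unfolding lessThan_atLeast0 by (rule bij_betw_imp_surj_on)
  define B where "B = disjointed (\<lambda>j. ball (h j) (e / 2))"
  have "B j \<in> sets borel" for j
    unfolding B_def disjointed_def by (intro sets.Diff sets.finite_UN) auto
  moreover have "disjoint_family_on B {..<card X}"
    unfolding B_def by (rule disjoint_family_on_mono[OF subset_UNIV disjoint_family_disjointed])
  moreover have "(\<Union>j<card X. B j) = UNIV"
  proof -
    have "(\<Union>j<card X. B j) = (\<Union>j<card X. ball (h j) (e / 2))"
      unfolding B_def lessThan_atLeast0 by (rule finite_UN_disjointed_eq)
    also have "\<dots> = (\<Union>x\<in>h ` {..<card X}. ball x (e / 2))" by (simp only: image_image)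
    also have "\<dots> = (\<Union>x\<in>X. ball x (e / 2))" unfolding h ..
    also have "\<dots> = UNIV" using X(2) by (rule top.extremum_uniqueI)
    finally show ?thesis .
  qed
  moreover have "dist x y < e" if "x \<in> B j" "y \<in> B j" for j x y
  proof -
    have "x \<in> ball (h j) (e / 2)" "y \<in> ball (h j) (e / 2)"
      using that[unfolded B_def, THEN subsetD[OF disjointed_subset]] .
    then show ?thesis using dist_triangle_half_r[of "h j" x e y] by simp
  qed
  ultimately show ?thesis
    by (intro exI[of _ B] exI[of _ "card X"] conjI allI ballI)
qed

text \<open>As the distance bound tends to 0, these sets decrease to the set of exact coincidences,
  a finite union of null sets; continuity from above does the rest.\<close>

lemma near_coincidence_small:
  fixes \<mu> :: "'g::{polish_space, topological_ab_group_add} measure"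
  assumes M: "haar_probability \<mu>" and div: "divisible_group TYPE('g)" and x0: "x0 \<noteq> (0::'g)"
    and S: "finite S" and e: "0 < e"
  shows "\<exists>\<eta>>0. {x. \<exists>k\<in>S. \<exists>m\<in>S. k \<noteq> m \<and> dist (int_multiple k x) (int_multiple m x) < \<eta>} \<in> sets \<mu> \<and>
    measure \<mu> {x. \<exists>k\<in>S. \<exists>m\<in>S. k \<noteq> m \<and> dist (int_multiple k x) (int_multiple m x) < \<eta>} < e"
proof -
  have sM [measurable_cong]: "sets \<mu> = sets borel" using M by (simp add: haar_probability_def)
  have sp [simp]: "space \<mu> = UNIV" using sets_eq_imp_space_eq[OF sM] by simp
  interpret prob_space \<mu> using M by (simp add: haar_probability_def)
  define D where "D n = {x::'g. \<exists>k\<in>S. \<exists>m\<in>S. k \<noteq> m \<and>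
    dist (int_multiple k x) (int_multiple m x) < inverse (real (Suc n))}" for n
  have D_meas: "D n \<in> sets \<mu>" for n
  proof -
    have "D n = {x\<in>space \<mu>. \<exists>k\<in>S. \<exists>m\<in>S. k \<noteq> m \<and>
      dist (int_multiple k x) (int_multiple m x) < inverse (real (Suc n))}" by (simp add: D_def)
    also have "\<dots> \<in> sets \<mu>" using S by measurable
    finally show ?thesis .
  qed
  have Inter: "(\<Inter>n. D n) \<subseteq>
    (\<Union>(k, m)\<in>{(k, m)\<in>S \<times> S. k \<noteq> m}. {x. int_multiple k x = int_multiple m x})"
  proof
    fix x assume "x \<in> (\<Inter>n. D n)"
    then have x: "x \<in> D n" for n by blast
    show "x \<in> (\<Union>(k, m)\<in>{(k, m)\<in>S \<times> S. k \<noteq> m}. {x. int_multiple k x = int_multiple m x})"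
    proof (rule ccontr)
      assume "\<not> ?thesis"
      then have ne: "int_multiple k x \<noteq> int_multiple m x" if "k \<in> S" "m \<in> S" "k \<noteq> m" for k m
        using that by auto
      \<comment> \<open>Off the coincidences the finitely many distances have a positive minimum, so
        the point drops out of some \<open>D n\<close>.\<close>
      let ?Y = "(\<lambda>(k, m). dist (int_multiple k x) (int_multiple m x)) ` {(k, m)\<in>S \<times> S. k \<noteq> m}"
      have finY: "finite ?Y" using S by (intro finite_imageI) (auto intro: finite_subset[of _ "S \<times> S"])
      have "?Y \<noteq> {}" using x[of 0] by (auto simp: D_def)
      then have "Min ?Y > 0" using finY ne by (simp add: case_prod_beta)
      then obtain n where n: "inverse (real (Suc n)) < Min ?Y"
        using reals_Archimedean by blast
      obtain k m where km: "k \<in> S" "m \<in> S" "k \<noteq> m"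
        "dist (int_multiple k x) (int_multiple m x) < inverse (real (Suc n))"
        using x[of n] by (auto simp: D_def)
      have "Min ?Y \<le> dist (int_multiple k x) (int_multiple m x)"
        using finY km by (intro Min_le) (auto intro!: image_eqI[of _ _ "(k, m)"])
      then show False using km n by simp
    qed
  qed
  have closed: "{x. int_multiple k x = (int_multiple m x :: 'g)} \<in> sets \<mu>" for k m
    unfolding sM by (intro borel_closed closed_Collect_eq continuous_int_multiple)
  have "measure \<mu> (\<Inter>n. D n) \<le> measure \<mu>
    (\<Union>(k, m)\<in>{(k, m)\<in>S \<times> S. k \<noteq> m}. {x. int_multiple k x = int_multiple m x})"
    using Inter closed S
    by (intro finite_measure_mono sets.finite_UN) (auto intro: finite_subset[of _ "S \<times> S"])
  also have "\<dots> \<le> (\<Sum>(k, m)\<in>{(k, m)\<in>S \<times> S. k \<noteq> m}. measure \<mu> {x. int_multiple k x = int_multiple m x})"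
    unfolding case_prod_beta using closed S
    by (intro finite_measure_subadditive_finite) (auto intro: finite_subset[of _ "S \<times> S"])
  also have "\<dots> = 0"
    using haar_probability_coincidence_null[OF M div x0] by (intro sum.neutral) auto
  finally have null: "measure \<mu> (\<Inter>n. D n) = 0" by (simp add: measure_le_0_iff)
  have "decseq D"
  proof (intro decseq_SucI subsetI)
    fix n x assume "x \<in> D (Suc n)"
    then obtain k m where km: "k \<in> S" "m \<in> S" "k \<noteq> m"
      "dist (int_multiple k x) (int_multiple m x) < inverse (real (Suc (Suc n)))"
      by (auto simp: D_def)
    moreover have "inverse (real (Suc (Suc n))) < inverse (real (Suc n))" by simp
    ultimately have "dist (int_multiple k x) (int_multiple m x) < inverse (real (Suc n))" by linarith
    then show "x \<in> D n" unfolding D_def using km(1,2,3) by blast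
  qed
  then have "(\<lambda>n. measure \<mu> (D n)) \<longlonglongrightarrow> 0"
    using finite_Lim_measure_decseq[of D] D_meas null by auto
  then have "eventually (\<lambda>n. measure \<mu> (D n) < e) sequentially" using e by (rule order_tendstoD(2))
  then obtain n where "measure \<mu> (D n) < e" by (auto simp: eventually_sequentially)
  then show ?thesis using D_meas[of n] unfolding D_def
    by (intro exI[of _ "inverse (real (Suc n))"]) auto
qed

text \<open>The tiling argument for \<open>T = int_multiple\<close>, the Foelner box of side
  \<open>n\<close>, and pieces of diameter below \<eta>, where \<open>D\<close> consists of the
  points with two different multiples closer than \<eta>.\<close>

lemma approximately_equivariant_map:
  fixes \<mu> :: "'g::{polish_space, topological_ab_group_add} measure" and c :: "'i \<Rightarrow> int"
  assumes M: "haar_probability \<mu>" and div: "divisible_group TYPE('g)" and x0: "x0 \<noteq> (0::'g)"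
    and cpt: "compact (UNIV :: 'g set)"
    and ind: "multiplicatively_independent J c" and J: "finite J" "\<forall>i\<in>J. c i \<noteq> 0"
    and e: "0 < e"
  shows "\<exists>G (g :: 'g \<Rightarrow> real). G \<in> sets \<mu> \<and> g \<in> borel_measurable \<mu> \<and> measure \<mu> G \<ge> 1 - e \<and>
     (\<forall>x\<in>G. \<forall>i\<in>J. g (int_multiple (c i) x) = g x + a i)"
proof -
  have sM [measurable_cong]: "sets \<mu> = sets borel" using M by (simp add: haar_probability_def)
  have sp: "space \<mu> = UNIV" using sets_eq_imp_space_eq[OF sM] by simp
  interpret prob_space \<mu> using M by (simp add: haar_probability_def)
  \<comment> \<open>The added 1 keeps \<open>N\<close> positive for empty \<open>J\<close>.\<close>
  define N where "N = real (card J) + 1"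
  have N: "N > 0" "real (card J) \<le> N" by (auto simp: N_def)
  define \<delta> where "\<delta> = e / 4"
  have \<delta>: "\<delta> > 0" using e by (simp add: \<delta>_def)
  \<comment> \<open>Error budget: \<open>e / 4\<close> each for the uncovered part, for the faces
    (through this \<open>n\<close>) and for the near coincidences (through the bound
    \<open>e / (8 * N)\<close>).\<close>
  obtain n :: nat where n: "8 * N / (e * \<delta>) < real n" using reals_Archimedean2 by blast
  have "0 < 8 * N / (e * \<delta>)" using N e \<delta> by simp
  then have n0: "0 < n" using n by (cases n) auto
  have \<theta>: "N * (2 / real n / \<delta>) \<le> e / 4"
    using n n0 e \<delta> by (simp add: field_simps)
  obtain S l where S: "finite S" "S \<noteq> {}" "0 \<notin> S"
    and label: "\<And>i k. i \<in> J \<Longrightarrow> k \<in> S \<Longrightarrow> l (c i * k) = l k + a i"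
    and foelner: "\<And>i. i \<in> J \<Longrightarrow> real (card (S - (*) (c i) ` S)) + real (card ((*) (c i) ` S - S))
       \<le> 2 / real n * real (card S)"
    using multiplicative_foelner_box[OF ind J(1) bspec[OF J(2)] n0, of a] by blast
  obtain \<eta> where \<eta>: "\<eta> > 0"
    and D: "{x. \<exists>k\<in>S. \<exists>m\<in>S. k \<noteq> m \<and> dist (int_multiple k x) (int_multiple m x :: 'g) < \<eta>} \<in> sets \<mu>"
      (is "?D \<in> _")
    and D_small: "measure \<mu> {x. \<exists>k\<in>S. \<exists>m\<in>S. k \<noteq> m \<and>
       dist (int_multiple k x) (int_multiple m x) < \<eta>} < e / (8 * N)"
    using near_coincidence_small[OF M div x0 S(1), of "e / (8 * N)"] e N by auto
  obtain B :: "nat \<Rightarrow> 'g set" and r where B: "\<And>j. B j \<in> sets borel" "disjoint_family_on B {..<r}"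
    "(\<Union>j<r. B j) = UNIV" and diam: "\<And>j x y. x \<in> B j \<Longrightarrow> y \<in> B j \<Longrightarrow> dist x y < \<eta>"
    using small_diameter_partition[OF cpt \<eta>] by metis
  have til: "approximate_tiling \<mu> int_multiple S J c a l B r ?D (2 / real n) \<delta>"
  proof unfold_locales
    show "space \<mu> = UNIV" by (rule sp)
    show "int_multiple k \<in> measurable \<mu> \<mu>" for k by measurable
    show "measure \<mu> (int_multiple k -` A) = measure \<mu> A" if "k \<noteq> 0" "A \<in> sets \<mu>" for k A
      using haar_probability_int_multiple[OF M div] that sM by auto
    show "int_multiple (k * m) x = int_multiple k (int_multiple m x)" for k m and x :: 'g
      by (rule int_multiple_mult)
    \<comment> \<open>Two multiples in one piece are closer than \<eta>, which off \<open>D\<close>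
      forces equal multipliers.\<close>
    show "k = m" if "x \<notin> ?D" "k \<in> S" "m \<in> S" "int_multiple k x \<in> B j" "int_multiple m x \<in> B j" for x k m j
      using that diam[OF that(4,5)] by blast
  qed (use S J label foelner B sM D \<delta> in \<open>simp_all\<close>)
  obtain G g where G: "G \<in> sets \<mu>" "g \<in> borel_measurable \<mu>"
    "measure \<mu> G \<ge> 1 - \<delta> - real (card J) * (2 * measure \<mu> ?D + 2 / real n / \<delta>)"
    "\<forall>x\<in>G. \<forall>i\<in>J. g (int_multiple (c i) x) = g x + a i"
    using approximate_tiling.approximate_equivariance[OF til] by blast
  have "real (card J) * (2 * measure \<mu> ?D + 2 / real n / \<delta>) \<le> N * (2 * (e / (8 * N)) + 2 / real n / \<delta>)"
    using N D_small \<delta> by (intro mult_mono add_mono) auto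
  also have "\<dots> = e / 4 + N * (2 / real n / \<delta>)" using N by (simp add: field_simps)
  also have "\<dots> \<le> e / 2" using \<theta> by simp
  finally have "measure \<mu> G \<ge> 1 - e" using G(3) e by (simp add: \<delta>_def)
  then show ?thesis using G by blast
qed

text \<open>Sending \<open>s\<close> to \<open>(s - z) mod int N\<close> injects
  \<open>{0..<int r}\<close> into the set of these shifts.\<close>

lemma card_shift_mod_ge:
  assumes "r \<le> N"
  shows "r \<le> card {t\<in>{0..<int N}. (z + t) mod int N < int r}"
proof -
  have "inj_on (\<lambda>s. (s - z) mod int N) {0..<int r}"
  proof (rule inj_onI)
    fix s t assume st: "s \<in> {0..<int r}" "t \<in> {0..<int r}" "(s - z) mod int N = (t - z) mod int N"
    then have "(z + (s - z) mod int N) mod int N = (z + (t - z) mod int N) mod int N" by simp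
    then have "s mod int N = t mod int N" by (simp add: mod_add_right_eq)
    then show "s = t" using st assms by simp
  qed
  moreover have "(\<lambda>s. (s - z) mod int N) ` {0..<int r} \<subseteq> {t\<in>{0..<int N}. (z + t) mod int N < int r}"
    using assms by (auto simp: mod_add_right_eq)
  ultimately have "card {0..<int r} \<le> card {t\<in>{0..<int N}. (z + t) mod int N < int r}"
    by (intro card_inj_on_le) (auto intro: finite_subset[of _ "{0..<int N}"])
  then show ?thesis by simp
qed

text \<open>Every point of \<open>G\<close> lies in at least \<open>r\<close> of the
  \<open>N\<close> sets \<open>A t\<close>, so their measures add up to at least
  \<open>r * measure M G\<close>, and some \<open>t\<close> reaches the average.\<close>

lemma (in prob_space) exists_good_shift:
  assumes G: "G \<in> sets M" and z: "z \<in> measurable M (count_space UNIV)"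
    and N: "0 < N" "r \<le> N"
  shows "\<exists>t. {x\<in>G. (z x + t) mod int N < int r} \<in> sets M \<and>
    measure M {x\<in>G. (z x + t) mod int N < int r} \<ge> real r / real N * measure M G"
proof -
  define A where "A t = {x\<in>G. (z x + t) mod int N < int r}" for t
  have A: "A t \<in> sets M" for t
  proof -
    have "A t = G \<inter> {x\<in>space M. (z x + t) mod int N < int r}"
      using sets.sets_into_space[OF G] by (auto simp: A_def)
    moreover have "{x\<in>space M. (z x + t) mod int N < int r} \<in> sets M"
      using measurable_sets[OF z, of "{i. (i + t) mod int N < int r}"]
      by (simp add: vimage_def Int_def conj_commute)
    ultimately show ?thesis using G by simp
  qed
  have "real r * measure M G = (\<integral>x. real r * indicator G x \<partial>M)"
    using G by simp
  also have "\<dots> \<le> (\<integral>x. (\<Sum>t\<in>{0..<int N}. indicator (A t) x) \<partial>M)"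
  proof (intro integral_mono)
    fix x
    show "real r * indicator G x \<le> (\<Sum>t\<in>{0..<int N}. indicator (A t) x)"
    proof (cases "x \<in> G")
      case True
      have "(\<Sum>t\<in>{0..<int N}. indicator (A t) x :: real)
          = (\<Sum>t\<in>{0..<int N}. if (z x + t) mod int N < int r then 1 else 0)"
        using True by (intro sum.cong) (auto simp: A_def)
      also have "\<dots> = real (card {t\<in>{0..<int N}. (z x + t) mod int N < int r})"
        by (subst sum.inter_filter[symmetric]) simp_all
      finally show ?thesis using True card_shift_mod_ge[OF N(2), of "z x"] by simp
    qed (simp add: sum_nonneg)
  qed (use A G in \<open>auto intro!: Bochner_Integration.integrable_sum integrable_real_indicator integrable_mult_right
      simp: less_top[symmetric]\<close>)
  also have "\<dots> = (\<Sum>t\<in>{0..<int N}. measure M (A t))"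
    using A by (subst Bochner_Integration.integral_sum) (auto intro!: integrable_real_indicator simp: less_top[symmetric])
  finally have sum: "real r * measure M G \<le> (\<Sum>t\<in>{0..<int N}. measure M (A t))" .
  have "\<exists>t\<in>{0..<int N}. measure M (A t) \<ge> real r / real N * measure M G"
  proof (rule ccontr)
    assume "\<not> ?thesis"
    then have "(\<Sum>t\<in>{0..<int N}. measure M (A t)) < (\<Sum>t\<in>{0..<int N}. real r / real N * measure M G)"
      using N by (intro sum_strict_mono) (auto simp: not_le)
    then show False using sum N by simp
  qed
  then show ?thesis using A unfolding A_def by blast
qed

section \<open>Free sets and colourings\<close>

lemma equation_free_edges_iff:
  "equation_free {(c i, c j) | i j. (i, j) \<in> E} X \<longleftrightarrow>
     (\<forall>i j x y. (i, j) \<in> E \<longrightarrow> x \<in> X \<longrightarrow> y \<in> X \<longrightarrow> int_multiple (c i) x \<noteq> int_multiple (c j) y)"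
  unfolding equation_free_def by auto

text \<open>For \<open>x\<close>, \<open>y\<close> in \<open>X\<close> with
  \<open>c i x = c j y\<close>, equivariance gives
  \<open>\<lfloor>g x\<rfloor> + a i = \<lfloor>g y\<rfloor> + a j\<close>. After the shift by
  \<open>t\<close> both floors have residues below \<open>r\<close>, so the arcs of \<open>i\<close>
  and \<open>j\<close> would meet, which the discretized colouring rules out along an edge.\<close>

lemma circular_colouring_imp_free_set:
  fixes \<mu> :: "'g::{polish_space, topological_ab_group_add} measure" and c :: "nat \<Rightarrow> int"
  assumes M: "haar_probability \<mu>" and div: "divisible_group TYPE('g)" and x0: "x0 \<noteq> (0::'g)"
    and cpt: "compact (UNIV :: 'g set)"
    and c0: "c 0 = 1" and c: "\<forall>i\<in>{1..d}. c i \<noteq> 0"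
    and ind: "multiplicatively_independent {1..d} c"
    and E: "E \<subseteq> {0..d} \<times> {0..d}"
    and A: "\<forall>v\<in>{0..d}. circle_open_interval (A v) \<and> measure lebesgue (A v) = p"
    and A_disj: "\<forall>(u, v)\<in>E. A u \<inter> A v = {}"
    and p: "0 < p" and e: "0 < e"
  shows "\<exists>X\<in>sets borel. equation_free {(c i, c j) | i j. (i, j) \<in> E} X \<and> p - e \<le> measure \<mu> X"
proof -
  have sM: "sets \<mu> = sets borel" using M by (simp add: haar_probability_def)
  interpret prob_space \<mu> using M by (simp add: haar_probability_def)
  have e2: "0 < e / 2" using e by simp
  \<comment> \<open>This yields \<open>r \<le> N\<close>, which the averaging over shifts
    requires.\<close>
  have p1: "p \<le> 1"
  proof -
    have "circle_open_interval (A 0)" "measure lebesgue (A 0) = p" using bspec[OF A, of 0] by simp_all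
    then show ?thesis using measure_circle_open_interval_le_1 by metis
  qed
  \<comment> \<open>Half of \<open>e\<close> pays for rounding to the grid, the other half for the
    complement of \<open>G\<close>.\<close>
  from circular_colouring_discretization[OF A E A_disj p e2]
  obtain N r :: nat and a :: "nat \<Rightarrow> int" where 1: "0 < N \<and> real r < real N * p \<and>
      p - e / 2 \<le> real r / real N \<and> (\<forall>(u, v)\<in>E. \<forall>s t. 0 \<le> s \<and> s < int r \<and> 0 \<le> t \<and> t < int r \<longrightarrow>
       (a u + s) mod int N \<noteq> (a v + t) mod int N)"
    by (elim exE)
  then have N: "0 < N" "real r < real N * p" "p - e / 2 \<le> real r / real N" by simp_all
  have disj: "(a u + s) mod int N \<noteq> (a v + t) mod int N"
    if "(u, v) \<in> E" "0 \<le> s" "s < int r" "0 \<le> t" "t < int r" for u v s t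
    using 1 that by auto
  have "real N * p \<le> real N * 1" using p1 by (intro mult_left_mono) auto
  then have rN: "r \<le> N" using N(2) by simp
  from approximately_equivariant_map[OF M div x0 cpt ind finite_atLeastAtMost c e2,
      of "\<lambda>i. real_of_int (a i - a 0)"]
  obtain G and g :: "'g \<Rightarrow> real" where 2: "G \<in> sets \<mu> \<and> g \<in> borel_measurable \<mu> \<and>
      measure \<mu> G \<ge> 1 - e / 2 \<and>
      (\<forall>x\<in>G. \<forall>i\<in>{1..d}. g (int_multiple (c i) x) = g x + real_of_int (a i - a 0))"
    by (elim exE)
  then have G: "G \<in> sets \<mu>" "g \<in> borel_measurable \<mu>" "measure \<mu> G \<ge> 1 - e / 2"
    by blast+
  have g: "g (int_multiple (c i) x) = g x + real_of_int (a i - a 0)"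
    if "x \<in> G" "i \<in> {1..d}" for x i
    using 2 that by blast
  \<comment> \<open>The increments are integers, so the floor of \<open>g\<close> inherits
    equivariance. Vertex 0 fits in because \<open>c 0 = 1\<close> and its increment is
    \<open>a 0 - a 0\<close>; this is why \<open>a 0\<close> is subtracted.\<close>
  have shift: "\<lfloor>g (int_multiple (c i) x)\<rfloor> = \<lfloor>g x\<rfloor> + a i - a 0" if "x \<in> G" "i \<in> {0..d}" for x i
  proof (cases "i = 0")
    case True
    then show ?thesis by (simp add: c0)
  next
    case False
    then have "i \<in> {1..d}" using that by auto
    from g[OF that(1) this] show ?thesis by linarith
  qed
  have "(\<lambda>x. \<lfloor>g x\<rfloor>) \<in> measurable \<mu> (count_space UNIV)"
    by (intro measurable_real_floor measurable_compose[OF G(2)])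
  from exists_good_shift[OF G(1) this N(1) rN]
  obtain t where 3: "{x\<in>G. (\<lfloor>g x\<rfloor> + t) mod int N < int r} \<in> sets \<mu> \<and>
      measure \<mu> {x\<in>G. (\<lfloor>g x\<rfloor> + t) mod int N < int r} \<ge> real r / real N * measure \<mu> G" ..
  define X where "X = {x\<in>G. (\<lfloor>g x\<rfloor> + t) mod int N < int r}"
  have X: "X \<in> sets \<mu>" and X_large: "measure \<mu> X \<ge> real r / real N * measure \<mu> G"
    using 3 unfolding X_def by blast+
  have "False" if ij: "(i, j) \<in> E" and x: "x \<in> X" and y: "y \<in> X"
    and eq: "int_multiple (c i) x = int_multiple (c j) y" for i j x y
  proof -
    define s where "s = (\<lfloor>g x\<rfloor> + t) mod int N"
    define s' where "s' = (\<lfloor>g y\<rfloor> + t) mod int N"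
    have ij': "i \<in> {0..d}" "j \<in> {0..d}" using ij E by auto
    have "\<lfloor>g x\<rfloor> + a i - a 0 = \<lfloor>g y\<rfloor> + a j - a 0"
      using shift[of x i] shift[of y j] x y ij' eq by (simp add: X_def)
    then have "a i + (\<lfloor>g x\<rfloor> + t) = a j + (\<lfloor>g y\<rfloor> + t)" by simp
    then have "(a i + s) mod int N = (a j + s') mod int N"
      by (simp only: s_def s'_def mod_add_right_eq)
    moreover have "0 \<le> s" "s < int r" "0 \<le> s'" "s' < int r"
      using x y N(1) unfolding s_def s'_def X_def by simp_all
    ultimately show False using disj[OF ij] by blast
  qed
  then have "equation_free {(c i, c j) | i j. (i, j) \<in> E} X"
    unfolding equation_free_edges_iff by metis
  moreover have "p - e \<le> measure \<mu> X"
  proof -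
    have "p - e = (p - e / 2) - e / 2" by simp
    also have "\<dots> \<le> real r / real N - (real r / real N) * (e / 2)"
    proof -
      have "(real r / real N) * (e / 2) \<le> 1 * (e / 2)"
        using rN N(1) e by (intro mult_right_mono) auto
      then show ?thesis using N(3) by linarith
    qed
    also have "\<dots> = real r / real N * (1 - e / 2)" by (simp add: algebra_simps)
    also have "\<dots> \<le> real r / real N * measure \<mu> G" using G(3) by (intro mult_left_mono) auto
    finally show ?thesis using X_large by linarith
  qed
  ultimately show ?thesis using X unfolding sM by blast
qed

text \<open>The upper bound: the sets \<open>B v\<close> have the measure of \<open>X\<close>, and a
  common point of two adjacent ones would give a solution inside \<open>X\<close>. Realised in the
  unit interval, they form a fractional colouring.\<close>

lemma free_set_imp_fractional_colouring:
  fixes \<mu> :: "'g::{polish_space, topological_ab_group_add} measure" and c :: "'v \<Rightarrow> int"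
  assumes M: "haar_probability \<mu>" and div: "divisible_group TYPE('g)"
    and V: "finite V" and c: "\<And>v. v \<in> V \<Longrightarrow> c v \<noteq> 0"
    and E: "E \<subseteq> V \<times> V"
    and X: "X \<in> sets borel" "equation_free {(c i, c j) | i j. (i, j) \<in> E} X"
  shows "\<exists>A :: 'v \<Rightarrow> real set.
    (\<forall>v\<in>V. A v \<subseteq> {0..<1} \<and> A v \<in> sets lebesgue \<and> measure lebesgue (A v) = measure \<mu> X) \<and>
    (\<forall>(u, v)\<in>E. A u \<inter> A v = {})"
proof -
  have sM [measurable_cong]: "sets \<mu> = sets borel" using M by (simp add: haar_probability_def)
  have sp: "space \<mu> = UNIV" using sets_eq_imp_space_eq[OF sM] by simp
  have P: "prob_space \<mu>" using M by (simp add: haar_probability_def)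
  \<comment> \<open>\<open>c v * C v\<close> is the same integer for all \<open>v\<close>, so a point of \<open>B u \<inter> B v\<close> solves the equation of \<open>uv\<close>.\<close>
  define C where "C v = (\<Prod>u\<in>V - {v}. c u)" for v
  define B where "B v = int_multiple (C v) -` X" for v
  have C0: "C v \<noteq> 0" for v unfolding C_def using V c by auto
  have B: "B v \<in> sets \<mu>" for v
  proof -
    have "int_multiple (C v) \<in> measurable \<mu> borel" by measurable
    from measurable_sets[OF this X(1)] show ?thesis by (simp add: B_def sp)
  qed
  have mB: "measure \<mu> (B v) = measure \<mu> X" for v
    unfolding B_def by (rule haar_probability_int_multiple[OF M div C0 X(1)])
  have disj: "B u \<inter> B v = {}" if uv: "(u, v) \<in> E" for u v
  proof (rule equals0I)
    fix x assume x: "x \<in> B u \<inter> B v"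
    have prod: "c w * C w = (\<Prod>u\<in>V. c u)" if "w \<in> V" for w
      unfolding C_def using prod.remove[OF V that, of c] by simp
    have "u \<in> V" "v \<in> V" using subsetD[OF E uv] by simp_all
    then have "int_multiple (c u) (int_multiple (C u) x) = int_multiple (c v) (int_multiple (C v) x)"
      by (simp only: int_multiple_mult[symmetric] prod)
    moreover have "int_multiple (C u) x \<in> X" "int_multiple (C v) x \<in> X"
      using x by (simp_all add: B_def)
    ultimately show False using X(2)[unfolded equation_free_edges_iff] uv by metis
  qed
  from events_realized_in_unit_interval[OF P V B]
  obtain A :: "'v \<Rightarrow> real set" where A: "(\<forall>v\<in>V. A v \<subseteq> {0..<1} \<and> A v \<in> sets lebesgue \<and>
      measure lebesgue (A v) = measure \<mu> (B v)) \<and>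
    (\<forall>u v. u \<in> V \<and> v \<in> V \<and> B u \<inter> B v = {} \<longrightarrow> A u \<inter> A v = {})" ..
  have "A u \<inter> A v = {}" if "(u, v) \<in> E" for u v
    using conjunct2[OF A] disj[OF that] subsetD[OF E that] by simp
  then have "\<forall>(u, v)\<in>E. A u \<inter> A v = {}" by blast
  then show ?thesis using conjunct1[OF A] unfolding mB by (intro exI[of _ A] conjI)
qed

section \<open>Admissible values of the two chromatic numbers and the density formula\<close>

definition circular_values :: "'v pair_pre_digraph \<Rightarrow> real set" where
  "circular_values \<Gamma> = {q. q > 0 \<and>
       (\<exists>A :: 'v \<Rightarrow> real set.
          (\<forall>v\<in>pverts \<Gamma>. circle_open_interval (A v) \<and> measure lebesgue (A v) = 1 / q) \<and>
          (\<forall>(u, v)\<in>parcs \<Gamma>. A u \<inter> A v = {}))}"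

definition fractional_values :: "'v pair_pre_digraph \<Rightarrow> real set" where
  "fractional_values \<Gamma> = {q. q > 0 \<and>
       (\<exists>A :: 'v \<Rightarrow> real set.
          (\<forall>v\<in>pverts \<Gamma>. A v \<subseteq> {0..<1} \<and> A v \<in> sets lebesgue \<and> measure lebesgue (A v) = 1 / q) \<and>
          (\<forall>(u, v)\<in>parcs \<Gamma>. A u \<inter> A v = {}))}"

text \<open>Keeps the circular chromatic number away from 0, so that reciprocals can be taken
  safely.\<close>

lemma circular_values_ge_1:
  assumes "v \<in> pverts \<Gamma>" "q \<in> circular_values \<Gamma>"
  shows "1 \<le> q"
proof -
  have "q > 0" "1 / q \<le> 1"
    using assms measure_circle_open_interval_le_1 unfolding circular_values_def by force+
  then show ?thesis by (simp add: field_simps)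
qed

text \<open>Cut the circle into \<open>d + 1\<close> equal arcs, one for each vertex. Absence of
  loops makes the two arcs of an edge different, hence disjoint.\<close>

lemma circular_values_nonempty:
  fixes \<Gamma> :: "nat pair_pre_digraph"
  assumes "pair_graph \<Gamma>" "pverts \<Gamma> = {0..d}"
  shows "circular_values \<Gamma> \<noteq> {}"
proof -
  interpret pair_graph \<Gamma> by fact
  define D where "D = real d + 1"
  have D: "D > 0" by (simp add: D_def)
  define A where "A v = {real v / D<..<(real v + 1) / D}" for v
  have "circle_open_interval (A v) \<and> measure lebesgue (A v) = 1 / D" if "v \<in> {0..d}" for v
  proof -
    have lt: "real v / D < (real v + 1) / D" using D by (simp add: divide_strict_right_mono)
    have "(real v + 1) / D \<le> 1" using that D by (simp add: D_def)
    moreover have "0 \<le> real v / D" using D by simp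
    ultimately have "frac x = x" if "x \<in> A v" for x
      using that unfolding A_def by (subst frac_eq) auto
    then have "A v = frac ` A v" by force
    then have "circle_open_interval (A v)"
      unfolding circle_open_interval_def using lt A_def by metis
    moreover have "measure lebesgue (A v) = 1 / D"
      using lt by (simp add: A_def diff_divide_distrib[symmetric])
    ultimately show ?thesis by simp
  qed
  moreover have "A u \<inter> A v = {}" if "(u, v) \<in> parcs \<Gamma>" for u v
  proof (rule equals0I)
    fix x assume "x \<in> A u \<inter> A v"
    then have "real u < real v + 1" "real v < real u + 1"
      using D by (auto simp: A_def field_simps)
    then have "u = v" by linarith
    then show False using that no_loops[of "(u, v)"] by auto
  qed
  ultimately have "D \<in> circular_values \<Gamma>"
    unfolding circular_values_def using D assms(2) by blast
  then show ?thesis by blast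
qed

theorem proposition3p10:
  fixes c :: "nat \<Rightarrow> int" and d :: nat
    and \<Gamma> :: "nat pair_pre_digraph"
    and F :: "(int \<times> int) set"
    and \<mu> :: "'g::{polish_space, topological_ab_group_add} measure"
  assumes "c 0 = 1"
    and "\<forall>i\<in>{1..d}. c i \<noteq> 0"
    and "multiplicatively_independent {1..d} c"
    and "pair_graph \<Gamma>"
    and "pverts \<Gamma> = {0..d}"
    and "star_extremal \<Gamma>"
    and "F = {(c i, c j) | i j. (i, j) \<in> parcs \<Gamma>}"
    and "compact (UNIV :: 'g set)"
    and "divisible_group TYPE('g)"
    and "\<exists>x::'g. x \<noteq> 0"
    and "haar_probability \<mu>"
  shows "free_density F \<mu> = 1 / circular_chromatic_number \<Gamma> \<and>
         1 / circular_chromatic_number \<Gamma> = 1 / fractional_chromatic_number \<Gamma>"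
proof
  let ?\<chi> = "circular_chromatic_number \<Gamma>"
  let ?D = "{measure \<mu> A | A. A \<in> sets borel \<and> equation_free F A}"
  interpret pair_graph \<Gamma> by fact
  interpret prob_space \<mu> using assms(11) by (simp add: haar_probability_def)
  have E: "parcs \<Gamma> \<subseteq> {0..d} \<times> {0..d}"
    using assms(5) in_arcsD1 in_arcsD2 by fastforce
  obtain x0 :: 'g where x0: "x0 \<noteq> 0" using assms(10) by blast
  have cv: "?\<chi> = Inf (circular_values \<Gamma>)"
    by (simp add: circular_chromatic_number_def circular_values_def)
  \<comment> \<open>Star-extremality makes the same number an infimum in two ways: fractional values
    serve the upper bound on the density, circular values the lower bound.\<close>
  have fv: "?\<chi> = Inf (fractional_values \<Gamma>)"
    using assms(6) by (simp add: star_extremal_def fractional_chromatic_number_def fractional_values_def)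
  have ne: "circular_values \<Gamma> \<noteq> {}" by (rule circular_values_nonempty[OF assms(4,5)])
  have "1 \<le> ?\<chi>" unfolding cv using ne circular_values_ge_1[of 0 \<Gamma>] assms(5)
    by (intro cInf_greatest) auto
  have upper: "m \<le> 1 / ?\<chi>" if "m \<in> ?D" for m
  proof -
    from that obtain X where "m = measure \<mu> X \<and> X \<in> sets borel \<and> equation_free F X"
      unfolding mem_Collect_eq ..
    then have X: "X \<in> sets borel" "equation_free F X" "m = measure \<mu> X" by simp_all
    show ?thesis
    \<comment> \<open>A null set has to be treated apart, since \<open>1 / m\<close> is 0 for
      \<open>m = 0\<close> and thus no admissible value.\<close>
    proof (cases "m > 0")
      case True
      have "c v \<noteq> 0" if "v \<in> {0..d}" for v using that assms(1,2) by (cases "v = 0") auto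
      from free_set_imp_fractional_colouring[OF assms(11,9) finite_atLeastAtMost this E X(1)
          X(2)[unfolded assms(7)]]
      have "1 / m \<in> fractional_values \<Gamma>"
        unfolding fractional_values_def assms(5) X(3)[symmetric] using True by simp
      moreover have "bdd_below (fractional_values \<Gamma>)"
        by (intro bdd_belowI[of _ 0]) (auto simp: fractional_values_def)
      ultimately have "?\<chi> \<le> 1 / m" unfolding fv by (intro cInf_lower)
      then show ?thesis using True \<open>1 \<le> ?\<chi>\<close> by (simp add: field_simps)
    next
      case False
      then show ?thesis using \<open>1 \<le> ?\<chi>\<close> by (smt (verit) divide_nonneg_nonneg)
    qed
  qed
  have D_bdd: "bdd_above ?D" using upper by (rule bdd_aboveI)
  have lower: "1 / q \<le> Sup ?D" if q: "q \<in> circular_values \<Gamma>" for q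
  \<comment> \<open>The free sets reach the value \<open>1 / q\<close> only up to an arbitrary
    \<open>e\<close>.\<close>
  proof (rule field_le_epsilon)
    fix e :: real assume e: "0 < e"
    obtain A where A: "\<forall>v\<in>{0..d}. circle_open_interval (A v) \<and> measure lebesgue (A v) = 1 / q"
      and A_disj: "\<forall>(u, v)\<in>parcs \<Gamma>. A u \<inter> A v = {}" and "q > 0"
      using q unfolding circular_values_def assms(5) mem_Collect_eq by (elim conjE exE)
    have "0 < 1 / q" using \<open>q > 0\<close> by simp
    from circular_colouring_imp_free_set[OF assms(11,9) x0 assms(8,1,2,3) E A A_disj this e]
    obtain X where X: "X \<in> sets borel" "equation_free F X" "1 / q - e \<le> measure \<mu> X"
      unfolding assms(7) by (elim bexE conjE)
    have "measure \<mu> X \<in> ?D" using X(1,2) by blast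
    then have "measure \<mu> X \<le> Sup ?D" using D_bdd by (rule cSup_upper)
    then show "1 / q \<le> Sup ?D + e" using X(3) by simp
  qed
  \<comment> \<open>Positivity of the supremum allows the bounds \<open>1 / q \<le> Sup ?D\<close>
    to be inverted before passing to the infimum over \<open>q\<close>.\<close>
  obtain q0 where "q0 \<in> circular_values \<Gamma>" using ne by blast
  then have "0 < Sup ?D"
    using lower[of q0] by (auto simp: circular_values_def intro: less_le_trans[of 0 "1 / q0"])
  have "1 / Sup ?D \<le> ?\<chi>" unfolding cv
  proof (intro cInf_greatest ne)
    fix q assume q: "q \<in> circular_values \<Gamma>"
    then have "0 < q" by (simp add: circular_values_def)
    then show "1 / Sup ?D \<le> q" using lower[OF q] \<open>0 < Sup ?D\<close> by (simp add: field_simps)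
  qed
  then have "1 / ?\<chi> \<le> Sup ?D" using \<open>1 \<le> ?\<chi>\<close> \<open>0 < Sup ?D\<close> by (simp add: field_simps)
  moreover have "Sup ?D \<le> 1 / ?\<chi>"
  proof (intro cSup_least upper)
    have "equation_free F {}" by (auto simp: equation_free_def)
    then show "?D \<noteq> {}" using sets.empty_sets[of borel] by blast
  qed
  ultimately show "free_density F \<mu> = 1 / ?\<chi>" unfolding free_density_def by linarith
  show "1 / ?\<chi> = 1 / fractional_chromatic_number \<Gamma>"
    using assms(6) by (simp add: star_extremal_def)
qed

end
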